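(* For every integer $n\ge 4$, the random $4$-out-of-$n$ subnetwork $\omega^n_4$ satisfies $$\mathbb{P}\big(\omega^n_4\in\{123212,\ 321232,\ 212321,\ 232123\}\big)=\tfrac14,$$ where a $4$-particle sorting network $(s_1,\ldots,s_6)$ is abbreviated as $s_1s_2\cdots s_6$.
   Context: Let $S_n$ be the symmetric group on $\{1,\ldots,n\}$, with composition $(\sigma\tau)(i):=\sigma(\tau(i))$, and write $\sigma=(\sigma(1),\ldots,\sigma(n))$. For $1\le s\le n-1$ let $\tau_s=(s\ \ s+1)\in S_n$ be the adjacent transposition (swap at location $s$), and let $\rho=(n,\ldots,2,1)$ be the reverse permutation. An $n$-particle sorting network is a sequence $\omega=(s_1,\ldots,s_N)$ with $N=\binom n2$ and $s_t\in\{1,\ldots,n-1\}$ such that $\tau_{s_1}\tau_{s_2}\cdots\tau_{s_N}=\rho$. We write $\sigma_t=\tau_{s_1}\cdots\tau_{s_t}$ for the configuration at time $t$, $0\le t\le N$ (so $\sigma_0$ is the identity). Given an $n$-particle sorting network $\omega$ and a subset $A=\{a_1<\cdots<a_m\}\subseteq\{1,\ldots,n\}$, the induced subnetwork $\omega|_A$ is the $m$-particle sorting network defined as follows: delete from each configuration $(\sigma_t(1),\ldots,\sigma_t(n))$ all elements not in $A$ and replace $a_i$ with $i$, to give a permutation in $S_m$; then remove all duplicates from the resulting sequence of permutations. The result is the sequence of configurations of $\omega|_A$. The uniform sorting network $\omega_n$ is a uniformly random element of the (finite) set of all $n$-particle sorting networks. For $m\le n$, the random $m$-out-of-$n$ subnetwork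 is $\omega^n_m:=(\omega_n)|_{\mathcal A}$, where $\mathcal A$ is a uniformly random $m$-element subset of $\{1,\ldots,n\}$ independent of $\omega_n$. *)

theory Defs
  imports "HOL-Probability.Probability_Mass_Function" "HOL-Combinatorics.Transposition"
begin

text \<open>
  Elements of \<open>S\<^sub>n\<close> are functions on \<^typ>\<open>nat\<close> that fix every point outside \<open>{1..n}\<close>.
\<close>

definition reverse_perm :: "nat \<Rightarrow> nat \<Rightarrow> nat" where
  "reverse_perm n = (\<lambda>i. if i \<in> {1..n} then n + 1 - i else i)"

definition swap_prod :: "nat list \<Rightarrow> nat \<Rightarrow> nat" where
  "swap_prod \<omega> = foldr (\<lambda>s \<sigma>. Transposition.transpose s (s + 1) \<circ> \<sigma>) \<omega> id"

definition sorting_network :: "nat \<Rightarrow> nat list \<Rightarrow> bool" where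
  "sorting_network n \<omega> \<longleftrightarrow>
     length \<omega> = n choose 2 \<and> set \<omega> \<subseteq> {1..n - 1} \<and> swap_prod \<omega> = reverse_perm n"

definition config :: "nat \<Rightarrow> nat list \<Rightarrow> nat \<Rightarrow> nat list" where
  "config n \<omega> t = map (swap_prod (take t \<omega>)) [1..<n + 1]"

definition configs :: "nat \<Rightarrow> nat list \<Rightarrow> nat list list" where
  "configs n \<omega> = map (config n \<omega>) [0..<length \<omega> + 1]"

text \<open>
  If \<open>A = {a\<^sub>1 < \<dots> < a\<^sub>m}\<close>, then \<^term>\<open>card {b \<in> A. b \<le> a\<^sub>i}\<close> is \<open>i\<close>.
\<close>

definition restrict_config :: "nat set \<Rightarrow> nat list \<Rightarrow> nat list" where
  "restrict_config A xs = map (\<lambda>a. card {b \<in> A. b \<le> a}) (filter (\<lambda>x. x \<in> A) xs)"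

text \<open>
  A network is determined by its configurations, so there is at most one candidate below.
  In a sorting network each pair of particles is swapped exactly once, so equal restricted
  configurations are always consecutive, and it does not matter which copy \<^const>\<open>remdups\<close> keeps.
\<close>

definition subnetwork :: "nat \<Rightarrow> nat set \<Rightarrow> nat list \<Rightarrow> nat list" where
  "subnetwork n A \<omega> = (THE \<omega>'. sorting_network (card A) \<omega>' \<and>
     configs (card A) \<omega>' = remdups (map (restrict_config A) (configs n \<omega>)))"

definition uniform_network :: "nat \<Rightarrow> nat list pmf" where
  "uniform_network n = pmf_of_set {\<omega>. sorting_network n \<omega>}"

definition random_subnetwork :: "nat \<Rightarrow> nat \<Rightarrow> nat list pmf" where
  "random_subnetwork m n = map_pmf (\<lambda>(\<omega>, A). subnetwork n A \<omega>)
     (pair_pmf (uniform_network n) (pmf_of_set {A. A \<subseteq> {1..n} \<and> card A = m}))"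

end

theory Submission
  imports Defs "HOL-Combinatorics.Permutations"
begin

text \<open>
  A 4-particle network has three swaps at location 2 if it is one of the four listed words, and two
  otherwise, so the probability is the expected number of swaps at location 2 minus 2. A swap of
  \<open>\<omega>\<^sub>n\<close> at location \<open>s\<close> becomes a swap at location 2 for exactly \<open>(s - 1) (n - 1 - s)\<close> of the
  4-element sets \<open>A\<close>, and the locations \<open>s\<^sub>t\<close> are identically distributed, since
  \<open>(s\<^sub>1, \<dots>, s\<^sub>N) \<mapsto> (n - s\<^sub>N, s\<^sub>1, \<dots>, s\<^sub>N\<^sub>-\<^sub>1)\<close> permutes the networks. It remains to know the
  distribution of \<open>s\<^sub>N\<close>, that is, the number of reduced words of \<open>\<rho> \<tau>\<^sub>r\<close> relative to that of \<open>\<rho>\<close>.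

  Instead of the Edelman-Greene correspondence we use the transition identity for numbers of reduced
  words: for every position \<open>k\<close>, the Bruhat covers \<open>w (k j)\<close> with \<open>j > k\<close> have as many reduced
  words in total as the covers \<open>w (i k)\<close> with \<open>i < k\<close>. For a dominant (132-avoiding) permutation it
  turns the recursion over descents into the recursion for standard Young tableaux, and all
  permutations occurring in it are dominant again. Hence the Frobenius formula counts the reduced
  words of dominant permutations, in particular of \<open>\<rho>\<close> and \<open>\<rho> \<tau>\<^sub>r\<close>. The resulting sum over \<open>r\<close> is a
  Vandermonde convolution of rising factorials of \<open>3/2\<close>.
\<close>

section \<open>Reduced words\<close>

abbreviation adj :: "nat \<Rightarrow> nat \<Rightarrow> nat" where
  "adj s \<equiv> Transposition.transpose s (Suc s)"

text \<open>Positions range over all naturals, so the inversion number does not refer to an ambient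
  \<open>n\<close>; \<open>finite_Inversions\<close> makes the cardinality meaningful for finitely
  supported permutations.\<close>

definition Inversions :: "(nat \<Rightarrow> nat) \<Rightarrow> (nat \<times> nat) set" where
  "Inversions w = {(i, j). i < j \<and> w j < w i}"

abbreviation inversions :: "(nat \<Rightarrow> nat) \<Rightarrow> nat" where
  "inversions w \<equiv> card (Inversions w)"

text \<open>By \<open>inversions_swap_prod_le\<close> the required length is the least that a word
  for \<open>w\<close> can have.\<close>

definition reduced_words :: "(nat \<Rightarrow> nat) \<Rightarrow> nat list set" where
  "reduced_words w = {\<omega>. swap_prod \<omega> = w \<and> length \<omega> = inversions w}"

abbreviation nwords :: "(nat \<Rightarrow> nat) \<Rightarrow> nat" where
  "nwords w \<equiv> card (reduced_words w)"

lemma swap_prod_Nil [simp]: "swap_prod [] = id"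
  by (simp add: swap_prod_def)

lemma swap_prod_Cons [simp]: "swap_prod (s # \<omega>) = adj s \<circ> swap_prod \<omega>"
  by (simp add: swap_prod_def)

lemma swap_prod_append [simp]: "swap_prod (u @ v) = swap_prod u \<circ> swap_prod v"
  by (induction u) (simp_all add: comp_assoc)

lemma bij_swap_prod: "bij (swap_prod \<omega>)"
proof (induction \<omega>)
  case (Cons s \<omega>)
  then have "bij (adj s \<circ> swap_prod \<omega>)" by (intro bij_comp) auto
  then show ?case by (simp add: comp_def)
qed (simp flip: id_def)

lemma permutation_swap_prod: "permutation (swap_prod \<omega>)"
proof (induction \<omega>)
  case (Cons s \<omega>)
  then have "permutation (adj s \<circ> swap_prod \<omega>)"
    by (intro permutation_compose permutation_swap_id)
  then show ?case by (simp add: comp_def)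
qed simp

lemma inv_swap_prod: "inv (swap_prod \<omega>) = swap_prod (rev \<omega>)"
proof (induction \<omega>)
  case (Cons s \<omega>)
  have "inv (adj s \<circ> swap_prod \<omega>) = inv (swap_prod \<omega>) \<circ> adj s"
    by (simp add: o_inv_distrib bij_swap_prod)
  with Cons show ?case by (simp add: comp_def)
qed (simp flip: id_def)

lemma comp_adj_adj [simp]: "w \<circ> adj r \<circ> adj r = w"
  by (simp add: comp_assoc)

lemma Inversions_id [simp]: "Inversions id = {}"
  by (auto simp: Inversions_def)

lemma adj_mono_iff:
  assumes "(i, j) \<noteq> (r, Suc r)" "(i, j) \<noteq> (Suc r, r)"
  shows "adj r i < adj r j \<longleftrightarrow> i < j"
  using assms by (auto simp: Transposition.transpose_def)

lemma permutation_bound: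
  fixes w :: "nat \<Rightarrow> nat"
  assumes "permutation w"
  shows "\<exists>M. (\<forall>i>M. w i = i) \<and> (\<forall>i\<le>M. w i \<le> M)"
proof -
  have fin: "finite {x. w x \<noteq> x}" and bij: "bij w" using assms by (auto simp: permutation)
  have "\<exists>M. \<forall>x\<in>{x. w x \<noteq> x}. x \<le> M"
    using fin by (simp only: finite_nat_set_iff_bounded_le)
  then obtain M where M: "\<forall>x\<in>{x. w x \<noteq> x}. x \<le> M" ..
  have 1: "w i = i" if "i > M" for i using M that by (meson mem_Collect_eq not_le)
  have 2: "w i \<le> M" if "i \<le> M" for i
  proof (rule ccontr)
    assume "\<not> w i \<le> M"
    then have "w (w i) = w i" using 1 by simp
    then have "w i = i" using bij by (simp add: bij_def inj_eq)
    with that \<open>\<not> w i \<le> M\<close> show False by simp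
  qed
  show ?thesis using 1 2 by blast
qed

lemma finite_Inversions:
  assumes "permutation w"
  shows "finite (Inversions w)"
proof -
  obtain M where M: "\<And>i. i > M \<Longrightarrow> w i = i" "\<And>i. i \<le> M \<Longrightarrow> w i \<le> M"
    using permutation_bound[OF assms] by blast
  have "Inversions w \<subseteq> {..M} \<times> {..M}"
  proof (clarsimp simp: Inversions_def)
    fix i j assume "i < j" "w j < w i"
    have "j \<le> M"
    proof (rule ccontr)
      assume "\<not> j \<le> M"
      then have "w j = j" "w i = i \<or> w i \<le> M"
        using M(1)[of j] M(1)[of i] M(2)[of i] by (simp, linarith)
      then show False using \<open>\<not> j \<le> M\<close> \<open>i < j\<close> \<open>w j < w i\<close> by auto
    qed
    with \<open>i < j\<close> show "i \<le> M \<and> j \<le> M" by simp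
  qed
  then show ?thesis by (rule finite_subset) simp
qed

text \<open>Exchanging positions \<open>r\<close> and \<open>Suc r\<close> relabels the old
  inversions, and the only new one is the pair \<open>(r, Suc r)\<close> itself.\<close>

lemma inversions_comp_adj:
  assumes "permutation w" "w r < w (Suc r)"
  shows "inversions (w \<circ> adj r) = Suc (inversions w)"
proof -
  let ?f = "\<lambda>(i, j). (adj r i, adj r j)"
  have "Inversions (w \<circ> adj r) = insert (r, Suc r) (?f ` Inversions w)"
  proof (intro equalityI subsetI; clarify)
    fix i j assume ij: "(i, j) \<in> Inversions (w \<circ> adj r)" and n: "(i, j) \<notin> ?f ` Inversions w"
    show "i = r \<and> j = Suc r"
    proof (rule ccontr)
      assume "\<not> (i = r \<and> j = Suc r)"
      then have "(adj r i, adj r j) \<in> Inversions w"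
        using ij adj_mono_iff[of i j r] by (auto simp: Inversions_def)
      then have "?f (adj r i, adj r j) \<in> ?f ` Inversions w" by (rule imageI)
      with n show False by simp
    qed
  next
    fix i j assume "(i, j) \<in> insert (r, Suc r) (?f ` Inversions w)"
    then consider "i = r" "j = Suc r" | a b where "i = adj r a" "j = adj r b" "(a, b) \<in> Inversions w"
      by auto
    then show "(i, j) \<in> Inversions (w \<circ> adj r)"
    proof cases
      case 1 then show ?thesis using assms by (simp add: Inversions_def)
    next
      case 2
      then have "(a, b) \<noteq> (r, Suc r)" "(a, b) \<noteq> (Suc r, r)"
        using assms by (auto simp: Inversions_def)
      then show ?thesis using 2 adj_mono_iff[of a b r] by (auto simp: Inversions_def)
    qed
  qed
  moreover have "inj_on ?f (Inversions w)"
    by (rule inj_onI) (auto simp: transpose_eq_iff)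
  moreover have "(r, Suc r) \<notin> ?f ` Inversions w"
    by (auto simp: Inversions_def Transposition.transpose_def split: if_splits)
  ultimately show ?thesis
    using finite_Inversions[OF assms(1)] by (simp add: card_image)
qed

lemma inversions_comp_adj_desc:
  assumes "permutation w" "w (Suc r) < w r"
  shows "inversions w = Suc (inversions (w \<circ> adj r))"
  using inversions_comp_adj[of "w \<circ> adj r" r] assms
  by (simp add: permutation_compose permutation_swap_id)

lemma permutation_eq_iff: "permutation w \<Longrightarrow> w x = w y \<longleftrightarrow> x = y"
  by (metis permutation_bijective bij_is_inj inj_eq)

lemma inversions_comp_adj_le:
  assumes "permutation w"
  shows "inversions (w \<circ> adj r) \<le> Suc (inversions w)"
proof (cases "w r < w (Suc r)")
  case False
  then have "w (Suc r) < w r" using permutation_eq_iff[OF assms, of r "Suc r"] by simp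
  then show ?thesis using inversions_comp_adj_desc[OF assms, of r] by simp
qed (simp add: inversions_comp_adj[OF assms])

lemma inversions_comp_swap_prod_le:
  assumes "permutation w"
  shows "inversions (w \<circ> swap_prod \<omega>) \<le> inversions w + length \<omega>"
proof (induction \<omega> rule: rev_induct)
  case (snoc r \<omega>)
  have "inversions (w \<circ> swap_prod \<omega> \<circ> adj r) \<le> Suc (inversions (w \<circ> swap_prod \<omega>))"
    by (intro inversions_comp_adj_le permutation_compose assms permutation_swap_prod)
  with snoc show ?case by (simp add: comp_def)
qed (simp add: comp_def)

lemma inversions_swap_prod_le: "inversions (swap_prod \<omega>) \<le> length \<omega>"
  using inversions_comp_swap_prod_le[OF permutation_id, of \<omega>] by simp

text \<open>If the last letter did not create an inversion, the shorter word would have more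
  inversions than letters. So the last letters of reduced words are exactly the descents, which
  yields the recursion \<open>nwords_right\<close>.\<close>

lemma snoc_reduced_words_iff:
  "\<omega> @ [r] \<in> reduced_words w \<longleftrightarrow> w (Suc r) < w r \<and> \<omega> \<in> reduced_words (w \<circ> adj r)"
proof
  assume "\<omega> @ [r] \<in> reduced_words w"
  then have w: "w = swap_prod \<omega> \<circ> adj r" and len: "Suc (length \<omega>) = inversions w"
    by (auto simp: reduced_words_def)
  have asc: "swap_prod \<omega> r < swap_prod \<omega> (Suc r)"
  proof (rule ccontr)
    assume "\<not> ?thesis"
    then have "swap_prod \<omega> (Suc r) < swap_prod \<omega> r"
      using permutation_eq_iff[OF permutation_swap_prod, of \<omega> r "Suc r"] by simp
    then have "inversions (swap_prod \<omega>) = Suc (inversions w)"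
      using inversions_comp_adj_desc[OF permutation_swap_prod] w by simp
    then show False using len inversions_swap_prod_le[of \<omega>] by simp
  qed
  with inversions_comp_adj[OF permutation_swap_prod asc] len w
  show "w (Suc r) < w r \<and> \<omega> \<in> reduced_words (w \<circ> adj r)"
    by (simp add: reduced_words_def)
next
  assume *: "w (Suc r) < w r \<and> \<omega> \<in> reduced_words (w \<circ> adj r)"
  then have p: "swap_prod \<omega> = w \<circ> adj r" by (simp add: reduced_words_def)
  then have w: "w = swap_prod \<omega> \<circ> adj r" by simp
  then have "permutation w"
    by (metis permutation_swap_prod permutation_compose permutation_swap_id)
  with * w show "\<omega> @ [r] \<in> reduced_words w"
    using inversions_comp_adj_desc[of w r] by (simp add: reduced_words_def)
qed

lemma finite_descents:
  assumes "permutation w"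
  shows "finite {r. w (Suc r) < w r}"
proof (rule finite_subset)
  show "{r. w (Suc r) < w r} \<subseteq> fst ` Inversions w"
    by (force simp: Inversions_def)
qed (simp add: finite_Inversions assms)

lemma reduced_words_id [simp]: "reduced_words id = {[]}"
  by (auto simp: reduced_words_def)

lemma reduced_words_snoc:
  assumes "w \<noteq> id"
  shows "reduced_words w = (\<Union>r\<in>{r. w (Suc r) < w r}. (\<lambda>\<omega>. \<omega> @ [r]) ` reduced_words (w \<circ> adj r))"
proof (intro equalityI subsetI)
  fix \<omega> assume \<omega>: "\<omega> \<in> reduced_words w"
  then have "\<omega> \<noteq> []" using assms by (auto simp: reduced_words_def)
  then obtain u r where "\<omega> = u @ [r]" by (metis rev_exhaust)
  then show "\<omega> \<in> (\<Union>r\<in>{r. w (Suc r) < w r}. (\<lambda>\<omega>. \<omega> @ [r]) ` reduced_words (w \<circ> adj r))"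
    using \<omega> by (auto simp: snoc_reduced_words_iff)
qed (auto simp: snoc_reduced_words_iff)

lemma finite_reduced_words:
  assumes "permutation w"
  shows "finite (reduced_words w)"
  using assms
proof (induction "inversions w" arbitrary: w rule: less_induct)
  case less
  show ?case
  proof (cases "w = id")
    case False
    have "finite (reduced_words (w \<circ> adj r))" if "w (Suc r) < w r" for r
      using less that inversions_comp_adj_desc[OF less.prems that]
      by (simp add: permutation_compose permutation_swap_id)
    then show ?thesis
      by (auto simp: reduced_words_snoc[OF False] finite_descents[OF less.prems])
  qed simp
qed

lemma nwords_right:
  assumes "permutation w" "w \<noteq> id"
  shows "nwords w = (\<Sum>r | w (Suc r) < w r. nwords (w \<circ> adj r))"
proof -
  have "nwords w = (\<Sum>r | w (Suc r) < w r. card ((\<lambda>\<omega>. \<omega> @ [r]) ` reduced_words (w \<circ> adj r)))"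
    unfolding reduced_words_snoc[OF assms(2)]
    by (rule card_UN_disjoint)
       (auto simp: finite_descents assms finite_reduced_words permutation_compose permutation_swap_id)
  then show ?thesis by (simp add: card_image inj_on_def)
qed

section \<open>Inverses and the recursion over first letters\<close>

lemma inversions_inv:
  assumes "permutation w"
  shows "inversions (inv w) = inversions w"
proof -
  have b: "bij w" using assms by (rule permutation_bijective)
  have "bij_betw (\<lambda>(i, j). (w j, w i)) (Inversions w) (Inversions (inv w))"
    by (rule bij_betw_byWitness[where f' = "\<lambda>(i, j). (inv w j, inv w i)"])
       (use b in \<open>auto simp: Inversions_def bij_is_inj bij_is_surj surj_f_inv_f\<close>)
  then show ?thesis by (metis bij_betw_same_card)
qed

lemma nwords_inv:
  assumes "permutation w"
  shows "nwords (inv w) = nwords w"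
proof -
  have b: "bij w" using assms by (rule permutation_bijective)
  have "inv (inv w) = w" using b by (rule inv_inv_eq)
  have "bij_betw rev (reduced_words w) (reduced_words (inv w))"
    by (rule bij_betw_byWitness[where f' = rev])
       (auto simp: reduced_words_def inversions_inv assms simp flip: inv_swap_prod,
         metis \<open>inv (inv w) = w\<close> inv_swap_prod)
  then show ?thesis by (metis bij_betw_same_card)
qed

text \<open>Reversing words exchanges the reduced words of \<open>w\<close> and
  \<open>inv w\<close>, so the recursion over last letters of \<open>inv w\<close> becomes one over
  first letters of \<open>w\<close>: \<open>s\<close> is admissible if the value
  \<open>Suc s\<close> stands to the left of \<open>s\<close>.\<close>

lemma nwords_left:
  assumes "permutation w" "w \<noteq> id"
  shows "nwords w = (\<Sum>s | inv w (Suc s) < inv w s. nwords (adj s \<circ> w))"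
proof -
  have b: "bij w" using assms permutation_bijective by blast
  have ne: "inv w \<noteq> id" using assms b by (metis inv_id inv_inv_eq)
  have "nwords w = nwords (inv w)" using assms nwords_inv by simp
  also have "\<dots> = (\<Sum>s | inv w (Suc s) < inv w s. nwords (inv w \<circ> adj s))"
    using nwords_right[OF permutation_inverse[OF assms(1)] ne] .
  also have "\<dots> = (\<Sum>s | inv w (Suc s) < inv w s. nwords (adj s \<circ> w))"
  proof (rule sum.cong)
    fix s
    have "inv (adj s \<circ> w) = inv w \<circ> adj s" using b by (simp add: o_inv_distrib)
    then show "nwords (inv w \<circ> adj s) = nwords (adj s \<circ> w)"
      using nwords_inv[of "adj s \<circ> w"] assms(1)
      by (simp add: permutation_compose permutation_swap_id)
  qed simp
  finally show ?thesis .
qed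

section \<open>Bruhat covers and the transition identity\<close>

text \<open>This is the criterion for \<open>w \<circ> tr i j\<close> to have exactly one inversion
  more than \<open>w\<close>, that is, to cover \<open>w\<close> in Bruhat order.\<close>

definition covers :: "(nat \<Rightarrow> nat) \<Rightarrow> nat \<Rightarrow> nat \<Rightarrow> bool" where
  "covers w i j \<longleftrightarrow> i < j \<and> w i < w j \<and> (\<forall>p. i < p \<and> p < j \<longrightarrow> w p < w i \<or> w j < w p)"

abbreviation tr :: "nat \<Rightarrow> nat \<Rightarrow> nat \<Rightarrow> nat" where
  "tr i j \<equiv> Transposition.transpose i j"

lemma covers_between: "covers w i j \<Longrightarrow> i < x \<Longrightarrow> x < j \<Longrightarrow> w x < w i \<or> w j < w x"
  by (simp add: covers_def)

lemma covers_pos: "covers w i j \<Longrightarrow> i < j"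
  by (simp add: covers_def)

lemma covers_less: "covers w i j \<Longrightarrow> w i < w j"
  by (simp add: covers_def)

lemma covers_cong:
  assumes "\<And>x. i \<le> x \<Longrightarrow> x \<le> j \<Longrightarrow> w' i < w' x \<longleftrightarrow> w i < w x"
    "\<And>x. i \<le> x \<Longrightarrow> x \<le> j \<Longrightarrow> w' x < w' i \<longleftrightarrow> w x < w i"
    "\<And>x. i \<le> x \<Longrightarrow> x \<le> j \<Longrightarrow> w' j < w' x \<longleftrightarrow> w j < w x"
  shows "covers w' i j \<longleftrightarrow> covers w i j"
  unfolding covers_def using assms by (metis less_imp_le order_refl)

text \<open>Exchanging the values \<open>s\<close> and \<open>Suc s\<close> alters the comparison of
  no positions but \<open>p\<close> and \<open>q\<close>. So a cover can be affected only if one of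
  these is an endpoint and the other lies strictly between the endpoints; but then a value strictly
  between the endpoint values contradicts the cover. The inequality on \<open>tr i j\<close> says
  that \<open>s\<close> is a left descent of the upper permutation.\<close>

lemma covers_adj_iff:
  assumes w: "inj w" and p: "w p = s" and q: "w q = Suc s"
    and ne: "(i, j) \<noteq> (p, q)" "(i, j) \<noteq> (q, p)"
  shows "covers w i j \<and> tr i j q < tr i j p \<longleftrightarrow> q < p \<and> covers (adj s \<circ> w) i j"
proof -
  let ?w = "adj s \<circ> w"
  have vals: "?w p = Suc s" "?w q = s" and pq: "p \<noteq> q" using p q by auto
  have oth: "w x = s \<longleftrightarrow> x = p" "w x = Suc s \<longleftrightarrow> x = q" for x
    using w p q by (metis injD)+
  have lt: "?w x < ?w y \<longleftrightarrow> w x < w y" if "(x, y) \<noteq> (p, q)" "(x, y) \<noteq> (q, p)" for x y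
    using adj_mono_iff[of "w x" "w y" s] that oth by auto
  have same: "covers ?w i j \<longleftrightarrow> covers w i j"
    if "i = p \<or> j = p \<Longrightarrow> q < i \<or> j < q" "i = q \<or> j = q \<Longrightarrow> p < i \<or> j < p"
    using that ne by (intro covers_cong lt) auto
  consider "i \<noteq> p" "i \<noteq> q" "j \<noteq> p" "j \<noteq> q" | "i = p" "j \<noteq> p" "j \<noteq> q" | "j = p" "i \<noteq> p" "i \<noteq> q"
    | "i = q" "j \<noteq> p" "j \<noteq> q" | "j = q" "i \<noteq> p" "i \<noteq> q" | "i = p" "j = p" | "i = q" "j = q"
    using ne by auto
  then show ?thesis
  proof cases
    case 1
    then show ?thesis using same by auto
  next
    case 2
    have claim: "q < p \<or> j < q" if c: "covers w p j"
    proof (rule ccontr)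
      assume "\<not> ?thesis"
      then have "p < q" "q < j" using 2 pq by simp_all
      from covers_between[OF c this] covers_less[OF c] show False using p q vals by linarith
    qed
    have e: "q < p \<or> j < q \<Longrightarrow> covers ?w i j \<longleftrightarrow> covers w i j"
      using 2 pq by (intro same) auto
    have t: "tr i j q = q" "tr i j p = j" using 2 pq by auto
    show ?thesis unfolding t
      using 2 claim e covers_pos[of w i j] covers_pos[of ?w i j] by (auto simp del: o_apply)
  next
    case 3
    have claim: "q < i \<or> p < q" if c: "covers ?w i p"
    proof (rule ccontr)
      assume "\<not> ?thesis"
      then have "i < q" "q < p" using 3 pq by simp_all
      from covers_between[OF c this] covers_less[OF c] show False using p q vals by linarith
    qed
    have e: "q < i \<or> p < q \<Longrightarrow> covers ?w i j \<longleftrightarrow> covers w i j"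
      using 3 pq by (intro same) auto
    have t: "tr i j q = q" "tr i j p = i" using 3 pq by auto
    show ?thesis unfolding t
      using 3 claim e covers_pos[of w i j] covers_pos[of ?w i j] by (auto simp del: o_apply)
  next
    case 4
    have claim: "p < q \<or> j < p" if c: "covers ?w q j"
    proof (rule ccontr)
      assume "\<not> ?thesis"
      then have "q < p" "p < j" using 4 pq by simp_all
      from covers_between[OF c this] covers_less[OF c] show False using p q vals by linarith
    qed
    have e: "p < q \<or> j < p \<Longrightarrow> covers ?w i j \<longleftrightarrow> covers w i j"
      using 4 pq by (intro same) auto
    have t: "tr i j q = j" "tr i j p = p" using 4 pq by auto
    show ?thesis unfolding t
      using 4 claim e covers_pos[of w i j] covers_pos[of ?w i j] by (auto simp del: o_apply)
  next
    case 5
    have claim: "p < i \<or> q < p" if c: "covers w i q"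
    proof (rule ccontr)
      assume "\<not> ?thesis"
      then have "i < p" "p < q" using 5 pq by simp_all
      from covers_between[OF c this] covers_less[OF c] show False using p q vals by linarith
    qed
    have e: "p < i \<or> q < p \<Longrightarrow> covers ?w i j \<longleftrightarrow> covers w i j"
      using 5 pq by (intro same) auto
    have t: "tr i j q = i" "tr i j p = p" using 5 pq by auto
    show ?thesis unfolding t
      using 5 claim e covers_pos[of w i j] covers_pos[of ?w i j] by (auto simp del: o_apply)
  qed (auto simp: covers_def)
qed

lemma covers_consecutive:
  assumes "inj w" "w i = s" "w j = Suc s" "i < j"
  shows "covers w i j"
  unfolding covers_def
proof (intro conjI allI impI)
  fix p assume "i < p \<and> p < j"
  then have "w p \<noteq> s" "w p \<noteq> Suc s" using assms by (metis injD less_irrefl)+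
  then show "w p < w i \<or> w j < w p" using assms by linarith
qed (use assms in auto)

lemma inv_comp_tr: "bij w \<Longrightarrow> inv (w \<circ> tr i j) = tr i j \<circ> inv w"
  by (simp add: o_inv_distrib)

lemma transposed_neq_id:
  assumes "covers w i j"
  shows "w \<circ> tr i j \<noteq> id"
proof
  assume "w \<circ> tr i j = id"
  then have "(w \<circ> tr i j) i = i" "(w \<circ> tr i j) j = j" by simp_all
  then show False using covers_pos[OF assms] covers_less[OF assms] by simp
qed

text \<open>
  Expanding every \<open>nwords (w \<circ> tr i j)\<close> along left descents gives the same sum for the permutations
  \<open>adj s \<circ> w\<close> below \<open>w\<close>, except for the pair of positions of the values \<open>s\<close> and \<open>Suc s\<close>.
  These exceptional terms telescope over \<open>s\<close>.
\<close>

lemma weighted_cover_sum: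
  fixes \<delta> :: "nat \<Rightarrow> int"
  assumes "w permutes {1..n}" "\<delta> 0 = \<delta> (Suc n)"
  shows "(\<Sum>(i, j) | j \<le> Suc n \<and> covers w i j. (\<delta> i - \<delta> j) * nwords (w \<circ> tr i j)) = 0"
  using assms(1)
proof (induction "inversions w" arbitrary: w rule: less_induct)
  case less
  define P where "P = {(i, j). i \<le> Suc n \<and> j \<le> Suc n}"
  have finP: "finite P"
    by (rule finite_subset[of _ "{..Suc n} \<times> {..Suc n}"]) (auto simp: P_def)
  define S where "S u = (\<Sum>(i, j)\<in>P. if covers u i j then (\<delta> i - \<delta> j) * int (nwords (u \<circ> tr i j)) else 0)"
    for u
  have S_eq: "S u = (\<Sum>(i, j) | j \<le> Suc n \<and> covers u i j. (\<delta> i - \<delta> j) * nwords (u \<circ> tr i j))" for u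
    unfolding S_def using finP
    by (intro sum.mono_neutral_cong_right) (auto simp: P_def covers_def split: if_splits)
  let ?p = "inv w"
  have b: "bij w" using less.prems by (rule permutes_bij)
  have pw: "permutation w" using less.prems by (rule permutes_imp_permutation[rotated]) simp
  have wp: "w (?p x) = x" for x using b by (simp add: bij_is_surj surj_f_inv_f)
  have fix0: "w x = x" if "x = 0 \<or> x > n" for x
    using that less.prems by (auto simp: permutes_def)
  have p_fix: "?p x = x" if "x = 0 \<or> x > n" for x
    using fix0[OF that] b by (metis bij_is_inj inv_f_f)
  have p_le: "?p x \<le> Suc n" if "x \<le> Suc n" for x
    using that permutes_inv[OF less.prems] permutes_in_image[of ?p "{1..n}" x] p_fix[of x]
    by (cases "x = 0 \<or> x > n") auto
  have p_lt: "?p (Suc s) < ?p s \<Longrightarrow> 1 \<le> s \<and> s < n" for s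
    using p_fix[of s] p_fix[of "Suc s"] permutes_in_image[OF permutes_inv[OF less.prems], of s]
      permutes_in_image[OF permutes_inv[OF less.prems], of "Suc s"] 
    by (auto simp: not_less)
  have inj_p: "?p x = ?p y \<longleftrightarrow> x = y" for x y using wp by metis
  \<comment> \<open>\<open>A s i j\<close> says that \<open>s\<close> is a possible first letter for
    the cover of \<open>w\<close> at \<open>(i, j)\<close>; \<open>B s i j\<close> says that
    \<open>s\<close> is a left descent of \<open>w\<close> and that the smaller permutation
    \<open>adj s \<circ> w\<close> has a cover at \<open>(i, j)\<close>.\<close>
  define A where "A s i j \<longleftrightarrow> covers w i j \<and> tr i j (?p (Suc s)) < tr i j (?p s)" for s i j
  define B where "B s i j \<longleftrightarrow> ?p (Suc s) < ?p s \<and> covers (adj s \<circ> w) i j" for s i j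
  define h where "h s i j = (\<delta> i - \<delta> j) * int (nwords (adj s \<circ> w \<circ> tr i j))" for s i j
  \<comment> \<open>A cover with \<open>j \<le> Suc n\<close> fixes everything above
    \<open>Suc n\<close>, so its left descents are at most \<open>n\<close>. The common range of
    \<open>s\<close> allows the order of summation to be exchanged.\<close>
  have exp: "int (nwords (w \<circ> tr i j)) = (\<Sum>s\<le>n. if tr i j (?p (Suc s)) < tr i j (?p s)
      then int (nwords (adj s \<circ> w \<circ> tr i j)) else 0)"
    if "covers w i j" "j \<le> Suc n" for i j
  proof -
    have "tr i j x = x" if "x > Suc n" for x
      using that \<open>covers w i j\<close> \<open>j \<le> Suc n\<close> by (intro transpose_apply_other) (auto simp: covers_def)
    moreover have "tr i j x \<le> Suc n" if "x \<le> Suc n" for x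
      using that \<open>covers w i j\<close> \<open>j \<le> Suc n\<close> by (auto simp: covers_def Transposition.transpose_def)
    ultimately have s_le: "s \<le> n" if "tr i j (?p (Suc s)) < tr i j (?p s)" for s
      using that p_fix[of s] p_fix[of "Suc s"] p_le[of s]
      by (metis Suc_le_mono le_Suc_eq not_less order_less_trans lessI not_le order_less_imp_le)
    have "nwords (w \<circ> tr i j) = (\<Sum>s | tr i j (?p (Suc s)) < tr i j (?p s). nwords (adj s \<circ> w \<circ> tr i j))"
      using nwords_left[OF permutation_compose[OF pw permutation_swap_id] transposed_neq_id[OF that(1)]]
      by (simp add: inv_comp_tr b comp_assoc)
    also have "\<dots> = (\<Sum>s\<in>{..n} \<inter> {s. tr i j (?p (Suc s)) < tr i j (?p s)}. nwords (adj s \<circ> w \<circ> tr i j))"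
      using s_le by (intro sum.cong) auto
    finally show ?thesis by (simp add: sum.If_cases)
  qed
  have "S w = (\<Sum>(i, j)\<in>P. \<Sum>s\<le>n. if A s i j then h s i j else 0)"
    unfolding S_def
    by (intro sum.cong refl) (auto simp: exp A_def h_def P_def sum_distrib_left intro!: sum.cong)
  also have "\<dots> = (\<Sum>s\<le>n. \<Sum>(i, j)\<in>P. if A s i j then h s i j else 0)"
    by (subst sum.swap) (simp add: case_prod_unfold)
  also have "\<dots> = (\<Sum>s\<le>n. (\<Sum>(i, j)\<in>P. if B s i j then h s i j else 0)
      + (\<delta> (?p s) - \<delta> (?p (Suc s))) * nwords w)"
  proof (rule sum.cong[OF refl])
    fix s assume "s \<in> {..n}"
    let ?a = "?p s" and ?b = "?p (Suc s)"
    have inP: "(?a, ?b) \<in> P" "(?b, ?a) \<in> P" using \<open>s \<in> {..n}\<close> p_le by (auto simp: P_def)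
    have ab: "?a \<noteq> ?b" by (simp add: inj_p)
    have AB: "A s i j \<longleftrightarrow> B s i j" if "(i, j) \<noteq> (?a, ?b)" "(i, j) \<noteq> (?b, ?a)" for i j
      unfolding A_def B_def
      using covers_adj_iff[OF bij_is_inj[OF b] wp wp that] .
    \<comment> \<open>At the exceptional pair the exchange of values undoes the exchange of
      positions, so the term is a multiple of \<open>nwords w\<close>.\<close>
    have conj: "adj s \<circ> w \<circ> tr ?a ?b = w" "adj s \<circ> w \<circ> tr ?b ?a = w"
      by (auto simp: fun_eq_iff Transposition.transpose_def wp inj_p) (metis wp inj_p b bij_inv_eq_iff)+
    define Q where "Q = P - {(?a, ?b), (?b, ?a)}"
    have split: "(\<Sum>(i, j)\<in>P. g i j) = (\<Sum>(i, j)\<in>Q. g i j) + g ?a ?b + g ?b ?a" for g :: "nat \<Rightarrow> nat \<Rightarrow> int"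
    proof -
      have "P = insert (?a, ?b) (insert (?b, ?a) Q)" using inP by (auto simp: Q_def)
      moreover have "(?a, ?b) \<notin> insert (?b, ?a) Q" "(?b, ?a) \<notin> Q" "finite Q"
        using ab finP by (auto simp: Q_def)
      ultimately show ?thesis by simp
    qed
    have eq: "(\<Sum>(i, j)\<in>Q. if A s i j then h s i j else 0) = (\<Sum>(i, j)\<in>Q. if B s i j then h s i j else 0)"
    proof (rule sum.cong[OF refl])
      fix x assume x: "x \<in> Q"
      obtain i j where ij: "x = (i, j)" by (cases x)
      then have "(i, j) \<noteq> (?a, ?b)" "(i, j) \<noteq> (?b, ?a)" using x by (auto simp: Q_def)
      then have "A s i j \<longleftrightarrow> B s i j" by (rule AB)
      then show "(case x of (i, j) \<Rightarrow> if A s i j then h s i j else 0)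
        = (case x of (i, j) \<Rightarrow> if B s i j then h s i j else 0)" by (simp add: ij)
    qed
    have w': "(adj s \<circ> w) ?a = Suc s" "(adj s \<circ> w) ?b = s" by (simp_all add: wp)
    \<comment> \<open>If \<open>?a < ?b\<close>, the exceptional pair occurs only on the
      \<open>A\<close> side, as \<open>(?a, ?b)\<close>; otherwise only on the \<open>B\<close>
      side, as \<open>(?b, ?a)\<close> and with the opposite sign. Both cases leave the same
      difference.\<close>
    show "(\<Sum>(i, j)\<in>P. if A s i j then h s i j else 0)
      = (\<Sum>(i, j)\<in>P. if B s i j then h s i j else 0) + (\<delta> ?a - \<delta> ?b) * int (nwords w)"
    proof (cases "?a < ?b")
      case True
      have "A s ?a ?b"
        using True covers_consecutive[OF bij_is_inj[OF b] wp wp True] by (simp add: A_def)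
      moreover have "\<not> A s ?b ?a" "\<not> B s ?a ?b" "\<not> B s ?b ?a"
        using True by (auto simp: A_def B_def covers_def wp)
      ultimately show ?thesis unfolding split eq by (simp add: h_def conj)
    next
      case False
      then have lt: "?b < ?a" using ab by simp
      have "\<not> A s ?a ?b" "\<not> A s ?b ?a" "\<not> B s ?a ?b"
        using lt by (auto simp: A_def B_def covers_def wp)
      moreover have "B s ?b ?a"
        unfolding B_def
        using lt covers_consecutive[OF inj_compose[OF inj_on_transpose bij_is_inj[OF b]] w'(2,1) lt]
        by blast
      ultimately show ?thesis unfolding split eq by (simp add: h_def conj algebra_simps)
    qed
  qed
  also have "\<dots> = (\<Sum>s\<le>n. \<Sum>(i, j)\<in>P. if B s i j then h s i j else 0)
      + (\<Sum>s\<le>n. \<delta> (?p s) - \<delta> (?p (Suc s))) * nwords w"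
    by (simp add: sum.distrib sum_distrib_right)
  \<comment> \<open>The sum telescopes to the values of \<open>\<delta>\<close> at the fixed
    positions \<open>0\<close> and \<open>Suc n\<close>, which agree.\<close>
  also have "(\<Sum>s\<le>n. \<delta> (?p s) - \<delta> (?p (Suc s))) = 0"
    using sum_telescope[of "\<lambda>s. \<delta> (?p s)" n] p_fix assms(2) by simp
  also have "(\<Sum>s\<le>n. \<Sum>(i, j)\<in>P. if B s i j then h s i j else 0) = 0"
  proof (rule sum.neutral, rule ballI)
    fix s assume "s \<in> {..n}"
    show "(\<Sum>(i, j)\<in>P. if B s i j then h s i j else 0) = 0"
    proof (cases "?p (Suc s) < ?p s")
      case True
      have s: "1 \<le> s" "s < n" using p_lt[OF True] by auto
      have perm: "adj s \<circ> w permutes {1..n}"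
        using s by (intro permutes_compose[OF less.prems] permutes_swap_id) auto
      have "inversions (adj s \<circ> w) < inversions w"
      proof -
        have "inversions ?p = Suc (inversions (?p \<circ> adj s))"
          using True pw by (intro inversions_comp_adj_desc permutation_inverse)
        moreover have "inv (adj s \<circ> w) = ?p \<circ> adj s" using b by (simp add: o_inv_distrib)
        moreover have "permutation (adj s \<circ> w)" using pw by (simp add: permutation_compose permutation_swap_id)
        ultimately show ?thesis using inversions_inv pw by (metis lessI)
      qed
      then have "S (adj s \<circ> w) = 0" using less.hyps perm S_eq by simp
      then show ?thesis unfolding S_def B_def h_def using True by simp
    next
      case False
      then show ?thesis by (simp add: B_def case_prod_unfold)
    qed
  qed
  finally show ?case using S_eq by simp
qed

text \<open>
  The covers include those through the positions \<open>0\<close> and \<open>Suc n\<close>, which are fixed by \<open>w\<close>.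
\<close>

lemma nwords_transition:
  assumes w: "w permutes {1..n}" and k: "k \<in> {1..n}"
    and j: "covers w k j" "j \<le> Suc n" "\<And>j'. covers w k j' \<Longrightarrow> j' \<le> Suc n \<Longrightarrow> j' = j"
    and i: "covers w i k" "\<And>i'. covers w i' k \<Longrightarrow> i' = i"
  shows "nwords (w \<circ> tr k j) = nwords (w \<circ> tr i k)"
proof -
  \<comment> \<open>With the indicator of position \<open>k\<close> as weight, only covers through
    \<open>k\<close> count: upward ones with sign plus, downward ones with sign minus. It vanishes
    at \<open>0\<close> and \<open>Suc n\<close> because \<open>k\<close> lies in
    \<open>{1..n}\<close>.\<close>
  let ?d = "\<lambda>x. of_bool (x = k) :: int"
  let ?g = "\<lambda>(i, j). (?d i - ?d j) * int (nwords (w \<circ> tr i j))"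
  have fin: "finite {(i, j). j \<le> Suc n \<and> covers w i j}"
    by (rule finite_subset[of _ "{..Suc n} \<times> {..Suc n}"]) (auto simp: covers_def)
  have ne: "i \<noteq> k" "j \<noteq> k" using i(1) j(1) by (auto simp: covers_def)
  have "0 = (\<Sum>(i, j) | j \<le> Suc n \<and> covers w i j. (?d i - ?d j) * nwords (w \<circ> tr i j))"
    using weighted_cover_sum[OF w, of ?d] k by simp
  also have "\<dots> = sum ?g {(k, j), (i, k)}"
  proof (rule sum.mono_neutral_right[OF fin])
    show "{(k, j), (i, k)} \<subseteq> {(i, j). j \<le> Suc n \<and> covers w i j}" using j(1,2) i(1) k by simp
    show "\<forall>x\<in>{(i, j). j \<le> Suc n \<and> covers w i j} - {(k, j), (i, k)}. ?g x = 0"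
    proof
      fix x assume x: "x \<in> {(i, j). j \<le> Suc n \<and> covers w i j} - {(k, j), (i, k)}"
      obtain a b where ab: "x = (a, b)" by (cases x)
      then have "(a, b) \<notin> {(k, j), (i, k)}" "b \<le> Suc n" "covers w a b"
        using x by auto
      then have "a \<noteq> k" "b \<noteq> k" using j(3) i(2) by blast+
      then show "?g x = 0" by (simp add: ab)
    qed
  qed
  also have "\<dots> = int (nwords (w \<circ> tr k j)) - int (nwords (w \<circ> tr i k))"
    using ne by simp
  finally show ?thesis by simp
qed

section \<open>Dominant permutations\<close>

text \<open>This is the Lehmer code. For dominant \<open>w\<close> it is the partition whose
  tableaux are counted below.\<close>

definition code :: "(nat \<Rightarrow> nat) \<Rightarrow> nat \<Rightarrow> nat" where
  "code w i = card {j. i < j \<and> w j < w i}"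

text \<open>The condition starts at position 1, because a permutation of \<open>{1..n}\<close> fixes
  0 and has code 0 there.\<close>

definition dominant :: "(nat \<Rightarrow> nat) \<Rightarrow> bool" where
  "dominant w \<longleftrightarrow> (\<forall>i\<ge>1. code w (Suc i) \<le> code w i)"

lemma finite_code_set:
  fixes w :: "nat \<Rightarrow> nat"
  assumes "permutation w"
  shows "finite {j. i < j \<and> w j < w i}"
  by (rule finite_surj[OF finite_Inversions[OF assms], of _ snd])
     (force simp: Inversions_def image_iff)

lemma dominant_antimono:
  assumes "dominant w" "1 \<le> i" "i \<le> k"
  shows "code w k \<le> code w i"
  using assms(3) assms(1,2)
  by (induction k rule: dec_induct) (auto simp: dominant_def intro: order_trans)

text \<open>In a pattern with \<open>i\<close> as close to \<open>k\<close> as possible, all values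
  between these positions exceed \<open>w i\<close>. Then every position counted by
  \<open>code w i\<close> is also counted by \<open>code w k\<close>, which counts \<open>m\<close>
  in addition, so the code would increase from \<open>i\<close> to \<open>k\<close>.\<close>

lemma dominant_avoids_132:
  assumes dom: "dominant w" and pw: "permutation w" and "1 \<le> i" "i < k" "k < m"
  shows "\<not> (w i < w m \<and> w m < w k)"
  using assms(3,4)
proof (induction "k - i" arbitrary: i rule: less_induct)
  case less
  show ?case
  proof
    assume pat: "w i < w m \<and> w m < w k"
    have no: "w i < w x" if "i < x" "x < k" for x
    proof (rule ccontr)
      assume "\<not> w i < w x"
      then have "w x < w m" using pat by simp
      then show False
        using less.hyps[of x, OF diff_less_mono2] that less.prems pat by simp
    qed
    have "{j. i < j \<and> w j < w i} \<subset> {j. k < j \<and> w j < w k}"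
    proof
      show "{j. i < j \<and> w j < w i} \<subseteq> {j. k < j \<and> w j < w k}"
      proof
        fix x assume "x \<in> {j. i < j \<and> w j < w i}"
        then have x: "i < x" "w x < w i" by auto
        then have "\<not> x < k" "x \<noteq> k" using no[of x] pat by auto
        then show "x \<in> {j. k < j \<and> w j < w k}" using x pat by simp
      qed
      show "{j. i < j \<and> w j < w i} \<noteq> {j. k < j \<and> w j < w k}"
      proof
        assume "{j. i < j \<and> w j < w i} = {j. k < j \<and> w j < w k}"
        moreover have "m \<in> {j. k < j \<and> w j < w k}" using pat \<open>k < m\<close> by simp
        ultimately have "m \<in> {j. i < j \<and> w j < w i}" by (simp only:)
        then show False using pat by simp
      qed
    qed
    then have "code w i < code w k"
      unfolding code_def by (rule psubset_card_mono[OF finite_code_set[OF pw]])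
    then show False using dominant_antimono[OF dom] less.prems by (metis less_imp_le not_less)
  qed
qed

lemma code_descent_iff:
  assumes pw: "permutation w"
  shows "code w (Suc r) < code w r \<longleftrightarrow> w (Suc r) < w r"
proof
  assume d: "w (Suc r) < w r"
  have "{j. Suc r < j \<and> w j < w (Suc r)} \<subset> {j. r < j \<and> w j < w r}"
    using d by auto
  then show "code w (Suc r) < code w r"
    unfolding code_def by (rule psubset_card_mono[OF finite_code_set[OF pw]])
next
  assume c: "code w (Suc r) < code w r"
  show "w (Suc r) < w r"
  proof (rule ccontr)
    assume "\<not> ?thesis"
    then have "{j. r < j \<and> w j < w r} \<subseteq> {j. Suc r < j \<and> w j < w (Suc r)}"
      by (auto, metis Suc_lessI)
    then have "code w r \<le> code w (Suc r)"
      unfolding code_def by (rule card_mono[OF finite_code_set[OF pw]])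
    with c show False by simp
  qed
qed

lemma ex_lower_cover:
  assumes pw: "permutation w" and d: "w (Suc r) < w r"
  shows "\<exists>j>r. w j < w r \<and> (\<forall>x>r. w x < w r \<longrightarrow> w x \<le> w j)"
proof -
  let ?A = "{j. r < j \<and> w j < w r}"
  have "finite ?A" "?A \<noteq> {}" using finite_code_set[OF pw] d by auto
  then obtain j where "j \<in> ?A" "\<forall>x\<in>?A. w x \<le> w j"
    using finite_imageI[of ?A w] Max_in[of "w ` ?A"] Max_ge[of "w ` ?A"]
    by (smt (verit) image_iff image_is_empty)
  then show ?thesis by auto
qed

text \<open>No value to the right of \<open>r\<close> lies strictly between \<open>w j\<close> and
  \<open>w r\<close>, so exchanging the two costs position \<open>r\<close> one smaller entry and
  leaves every other count unchanged. On the shape this removes a box from row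
  \<open>r\<close>.\<close>

lemma code_comp_tr:
  assumes pw: "permutation w" and j: "r < j" "w j < w r" "\<forall>x>r. w x < w r \<longrightarrow> w x \<le> w j"
  shows "code (w \<circ> tr r j) i = (if i = r then code w r - 1 else code w i)"
proof -
  have gap: "w x < w r \<longleftrightarrow> w x < w j" if "x > r" "x \<noteq> j" for x
    using j that permutation_eq_iff[OF pw, of x j] by (metis le_neq_implies_less order_less_trans)
  have gap': "w r < w x \<longleftrightarrow> w j < w x" if "x > r" "x \<noteq> j" for x
    using gap[OF that] permutation_eq_iff[OF pw, of x j] permutation_eq_iff[OF pw, of x r] that
    by (metis linorder_neqE_nat order_less_asym order_less_trans less_irrefl)
  consider "i < r" | "i = r" | "r < i" "i < j" | "i = j" | "j < i" by linarith
  then show ?thesis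
  proof cases
    case 1
    have "bij_betw (tr r j) {x. i < x \<and> (w \<circ> tr r j) x < (w \<circ> tr r j) i} {x. i < x \<and> w x < w i}"
      by (rule bij_betw_byWitness[where f' = "tr r j"])
         (use 1 j(1) in \<open>auto simp: Transposition.transpose_def split: if_splits\<close>)
    then show ?thesis using 1 bij_betw_same_card by (auto simp: code_def)
  next
    case 2
    have "{x. r < x \<and> w x < w r} = insert j {x. r < x \<and> (w \<circ> tr r j) x < (w \<circ> tr r j) r}"
      using j gap by (auto simp: Transposition.transpose_def split: if_splits)
    moreover have "j \<notin> {x. r < x \<and> (w \<circ> tr r j) x < (w \<circ> tr r j) r}" using j by simp
    moreover have "finite {x. r < x \<and> (w \<circ> tr r j) x < (w \<circ> tr r j) r}"
      using finite_code_set[OF permutation_compose[OF pw permutation_swap_id]] .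
    ultimately show ?thesis using 2 by (simp add: code_def)
  next
    case 3
    have "{x. i < x \<and> (w \<circ> tr r j) x < (w \<circ> tr r j) i} = {x. i < x \<and> w x < w i}"
      using 3 gap'[of i] by (auto simp: Transposition.transpose_def split: if_splits)
    then show ?thesis using 3 by (simp add: code_def)
  next
    case 4
    have "{x. i < x \<and> (w \<circ> tr r j) x < (w \<circ> tr r j) i} = {x. i < x \<and> w x < w i}"
      using 4 j(1) gap by (auto simp: Transposition.transpose_def split: if_splits)
    then show ?thesis using 4 j(1) by (simp add: code_def)
  next
    case 5
    have "{x. i < x \<and> (w \<circ> tr r j) x < (w \<circ> tr r j) i} = {x. i < x \<and> w x < w i}"
      using 5 j(1) by (auto simp: Transposition.transpose_def split: if_splits)
    then show ?thesis using 5 j(1) by (simp add: code_def)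
  qed
qed

text \<open>At a descent the code drops strictly, so lowering it there by one keeps it weakly
  decreasing.\<close>

lemma dominant_comp_tr:
  assumes dom: "dominant w" and pw: "permutation w" and "w (Suc r) < w r"
    and j: "r < j" "w j < w r" "\<forall>x>r. w x < w r \<longrightarrow> w x \<le> w j"
  shows "dominant (w \<circ> tr r j)"
  unfolding dominant_def code_comp_tr[OF pw j]
  using dom code_descent_iff[OF pw, of r] assms(3) by (auto simp: dominant_def) 

lemma inversions_eq_sum_code:
  assumes "w permutes {1..n}"
  shows "inversions w = (\<Sum>i=1..n. code w i)"
proof -
  have pw: "permutation w" using assms by (rule permutes_imp_permutation[rotated]) simp
  have fixed: "w x = x" if "x = 0 \<or> x > n" for x using that assms by (auto simp: permutes_def)
  have "Inversions w = (SIGMA i:{1..n}. {j. i < j \<and> w j < w i})"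
  proof (auto simp: Inversions_def)
    fix i j assume ij: "i < j" "w j < w i"
    show "Suc 0 \<le> i" using ij fixed[of i] by (cases "i = 0") auto
    show "i \<le> n"
    proof (rule ccontr)
      assume "\<not> i \<le> n" then show False using ij fixed[of i] fixed[of j] by auto
    qed
  qed
  then show ?thesis using finite_code_set[OF pw] by (simp add: code_def)
qed

lemma descent_bounds:
  assumes w: "w permutes {1..n}" and d: "w (Suc r) < w r"
  shows "1 \<le> r" "Suc r \<le> n"
proof -
  have fixed: "w x = x" if "x = 0 \<or> x > n" for x using that permutes_not_in[OF w] by auto
  show "1 \<le> r" using d fixed[of 0] by (cases "r = 0") auto
  show "Suc r \<le> n"
  proof (rule ccontr)
    assume n: "\<not> Suc r \<le> n"
    then have "w (Suc r) = Suc r" using fixed by simp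
    moreover have "w r \<le> r"
      using fixed[of r] permutes_in_image[OF w, of r] n \<open>1 \<le> r\<close> by (cases "r = n") auto
    ultimately show False using d by simp
  qed
qed

lemma lower_position_le:
  fixes w :: "nat \<Rightarrow> nat"
  assumes w: "w permutes {1..n}" and "1 \<le> r" "r < j" "w j < w r"
  shows "j \<le> n"
proof (rule ccontr)
  assume n: "\<not> j \<le> n"
  then have "w j = j" using permutes_not_in[OF w, of j] by simp
  moreover have "r > n \<Longrightarrow> w r = r" by (intro permutes_not_in[OF w]) simp
  moreover have "r \<le> n \<Longrightarrow> w r \<le> n" using permutes_in_image[OF w, of r] assms(2) by auto
  ultimately show False using assms n by linarith
qed

text \<open>
  If \<open>w j\<close> is the largest value below \<open>w r\<close> to the right of \<open>r\<close>, the permutation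
  \<open>w \<circ> adj r \<circ> tr (Suc r) j\<close> has exactly one cover through position \<open>Suc r\<close> on either side:
  132-avoidance excludes all others.
\<close>

lemma nwords_dominant_descent:
  assumes dom: "dominant w" and w: "w permutes {1..n}" and d: "w (Suc r) < w r"
    and j: "r < j" "w j < w r" "\<forall>x>r. w x < w r \<longrightarrow> w x \<le> w j"
  shows "nwords (w \<circ> adj r) = nwords (w \<circ> tr r j)"
proof (cases "j = Suc r")
  case False
  then have j': "Suc r < j" using j(1) by simp
  have pw: "permutation w" using w by (rule permutes_imp_permutation[rotated]) simp
  have fixed: "w x = x" if "x = 0 \<or> x > n" for x using that permutes_not_in[OF w] by auto
  have r1: "1 \<le> r" using descent_bounds[OF w d] by simp
  have jn: "j \<le> n" using lower_position_le[OF w r1 j(1,2)] .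
  have Vj: "w (Suc r) < w j"
    using j d False permutation_eq_iff[OF pw, of j "Suc r"] by (metis le_neq_implies_less lessI)
  \<comment> \<open>\<open>?v\<close> is covered by both permutations to be compared: exchanging
    \<open>Suc r\<close> with \<open>j\<close> gives \<open>w \<circ> adj r\<close>, exchanging
    \<open>r\<close> with \<open>Suc r\<close> gives \<open>w \<circ> tr r j\<close>.\<close>
  let ?v = "w \<circ> adj r \<circ> tr (Suc r) j"
  have v: "?v r = w (Suc r)" "?v (Suc r) = w j" "?v j = w r"
    using j' by (auto simp: Transposition.transpose_def)
  have vo: "?v x = w x" if "x \<noteq> r" "x \<noteq> Suc r" "x \<noteq> j" for x
    using that by (simp add: Transposition.transpose_def)
  have avoid: "\<not> (w a < w c \<and> w c < w b)" if "1 \<le> a" "a < b" "b < c" for a b c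
    using dominant_avoids_132[OF dom pw that] .
  have vp: "?v permutes {1..n}"
    using r1 jn j' by (intro permutes_compose w permutes_swap_id) auto
  have "nwords (?v \<circ> tr (Suc r) j) = nwords (?v \<circ> tr r (Suc r))"
  proof (rule nwords_transition[OF vp])
    show "Suc r \<in> {1..n}" using jn j' by simp
    show "covers ?v (Suc r) j"
      unfolding covers_def v
    proof (intro conjI allI impI j' j(2))
      fix p assume p: "Suc r < p \<and> p < j"
      then have "w p \<noteq> w r" "w p \<noteq> w j" using permutation_eq_iff[OF pw] by auto
      moreover have "w p < w r \<longrightarrow> w p \<le> w j" using j(3) p by simp
      ultimately show "?v p < w j \<or> w r < ?v p"
        using vo[of p] p by simp linarith
    qed
    show "j \<le> Suc n" using jn by simp
    show "b = j" if c: "covers ?v (Suc r) b" "b \<le> Suc n" for b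
    proof (rule ccontr)
      assume "b \<noteq> j"
      have b: "Suc r < b" "w j < ?v b" using covers_pos[OF c(1)] covers_less[OF c(1)] v by auto
      then have vb: "?v b = w b" using vo \<open>b \<noteq> j\<close> by simp
      \<comment> \<open>To the left of \<open>j\<close>, such a \<open>b\<close> would give the
        pattern 132 at \<open>Suc r\<close>, \<open>b\<close>, \<open>j\<close>. To the right of
        \<open>j\<close>, maximality of \<open>w j\<close> forces \<open>w b\<close> above
        \<open>w r\<close>, and position \<open>j\<close> with value \<open>w r\<close> blocks the
        cover.\<close>
      show False
      proof (cases "b < j")
        case True
        then show False using avoid[of "Suc r" b j] b vb Vj r1 by auto
      next
        case False
        have "w b < w r \<longrightarrow> w b \<le> w j" using j(3) b by simp
        moreover have "w b \<noteq> w r" using b permutation_eq_iff[OF pw, of b r] by simp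
        ultimately have "w r < w b" using b(2) vb by linarith
        then show False using covers_between[OF c(1), of j] j' v vb False \<open>b \<noteq> j\<close> j(2) by simp
      qed
    qed
    show "covers ?v r (Suc r)" unfolding covers_def v using Vj by auto
    show "a = r" if c: "covers ?v a (Suc r)" for a
    proof (rule ccontr)
      assume "a \<noteq> r"
      then have a: "a < r" using covers_pos[OF c] by simp
      then have va: "?v a = w a" using vo[of a] j(1) by simp
      have "w a < w j" using covers_less[OF c] v va by simp
      \<comment> \<open>Avoidance concerns positions from 1 on. At the fixed position 0 the cover is
        instead blocked by position \<open>r\<close>, where \<open>?v\<close> has the value
        \<open>w (Suc r)\<close>.\<close>
      show False
      proof (cases "a = 0")
        case True
        then have "w a < w (Suc r)" using fixed[of 0] permutation_eq_iff[OF pw, of "Suc r" 0] by simp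
        then show False using covers_between[OF c, of r] a v va Vj by simp
      next
        case False
        then have "\<not> (w a < w j \<and> w j < w r)" using avoid[of a r j] a j(1) by simp
        then show False using \<open>w a < w j\<close> j(2) by simp
      qed
    qed
  qed
  moreover have "?v \<circ> tr (Suc r) j = w \<circ> adj r" by (simp add: comp_assoc)
  moreover have "?v \<circ> tr r (Suc r) = w \<circ> tr r j"
    using j' by (auto simp: fun_eq_iff Transposition.transpose_def)
  ultimately show ?thesis by simp
qed simp

section \<open>The Frobenius formula\<close>

text \<open>The factor by which the Vandermonde product of \<open>l\<close> changes when
  \<open>l r\<close> is lowered by one; see \<open>prod_pairs_decrement\<close>.\<close>

definition shift_ratio :: "('a \<Rightarrow> real) \<Rightarrow> 'a set \<Rightarrow> 'a \<Rightarrow> real" where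
  "shift_ratio l S r = (\<Prod>j\<in>S - {r}. (l r - 1 - l j) / (l r - l j))"

lemma shift_factor:
  fixes u y :: real
  assumes "u \<noteq> y"
  shows "(u - 1 - y) / (u - y) = 1 + 1 / (y - u)"
proof -
  have "(u - 1 - y) / (u - y) = (u - y) / (u - y) - 1 / (u - y)"
    by (simp only: diff_divide_distrib)
  also have "1 / (u - y) = - (1 / (y - u))"
    by (metis minus_diff_eq minus_divide_right)
  finally show ?thesis using assms by simp
qed

lemma shift_factor_partial_fractions:
  fixes u x y :: real
  assumes "x \<noteq> u" "x \<noteq> y" "u \<noteq> y"
  shows "1 / (x - u) * ((x - 1 - y) / (x - y)) = (1 + 1 / (y - u)) / (x - u) - 1 / (y - u) / (x - y)"
proof -
  have "1 / (x - y) - 1 / (x - u) = (y - u) / ((x - y) * (x - u))"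
    using assms by (simp add: diff_frac_eq)
  then have "1 / (x - u) * (1 / (x - y)) = (1 / (x - y) - 1 / (x - u)) / (y - u)"
    using assms by simp
  moreover have "1 / (y - x) = - (1 / (x - y))"
    by (metis minus_diff_eq minus_divide_right)
  ultimately show ?thesis
    unfolding shift_factor[OF assms(2)] using assms
    by (simp add: distrib_left add_divide_distrib diff_divide_distrib mult.commute)
qed

lemma shift_ratio_insert:
  assumes "finite S" "a \<notin> S" "r \<in> S"
  shows "shift_ratio l (insert a S) r = shift_ratio l S r * ((l r - 1 - l a) / (l r - l a))"
proof -
  have "insert a S - {r} = insert a (S - {r})" using assms by auto
  then show ?thesis using assms by (simp add: shift_ratio_def)
qed

lemma shift_ratio_insert_new:
  assumes "a \<notin> S"
  shows "shift_ratio l (insert a S) a = (\<Prod>j\<in>S. (l a - 1 - l j) / (l a - l j))"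
  using assms by (simp add: shift_ratio_def)

text \<open>This is the partial fraction expansion of \<open>P (x - 1) / P x\<close>, where
  \<open>P\<close> is the monic polynomial with roots \<open>l j\<close>; the residue at
  \<open>l r\<close> is minus the shift ratio. Each new root is split off with
  \<open>shift_factor_partial_fractions\<close>.\<close>

lemma prod_shift_partial_fractions:
  assumes "finite S" "inj_on l S" "x \<notin> l ` S"
  shows "(\<Prod>j\<in>S. (x - 1 - l j) / (x - l j)) = 1 - (\<Sum>r\<in>S. shift_ratio l S r / (x - l r))"
  using assms
proof (induction S arbitrary: x rule: finite_induct)
  case (insert a S)
  let ?W = "shift_ratio l S"
  let ?y = "l a"
  have xy: "x \<noteq> ?y" and xS: "x \<notin> l ` S" and yS: "?y \<notin> l ` S" and inj: "inj_on l S"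
    using insert.prems insert.hyps by auto
  have R: "shift_ratio l (insert a S) a = 1 - (\<Sum>r\<in>S. ?W r / (?y - l r))"
    using shift_ratio_insert_new[OF insert.hyps(2)] insert.IH[OF inj yS] by simp
  have tm: "?W r / (x - l r) * ((x - 1 - ?y) / (x - ?y))
      = shift_ratio l (insert a S) r / (x - l r) - ?W r / (?y - l r) / (x - ?y)" if "r \<in> S" for r
  proof -
    have ne: "x \<noteq> l r" "l r \<noteq> ?y" using imageI[OF that, of l] xS yS by auto
    have "?W r / (x - l r) * ((x - 1 - ?y) / (x - ?y))
        = ?W r * (1 / (x - l r) * ((x - 1 - ?y) / (x - ?y)))" by simp
    then show ?thesis
      unfolding shift_ratio_insert[OF insert.hyps that] shift_factor[OF ne(2)]
        shift_factor_partial_fractions[OF ne(1) xy ne(2)]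
      by (simp add: right_diff_distrib)
  qed
  have "(\<Prod>j\<in>insert a S. (x - 1 - l j) / (x - l j))
      = (1 - (\<Sum>r\<in>S. ?W r / (x - l r))) * ((x - 1 - ?y) / (x - ?y))"
    using insert.hyps insert.IH[OF inj xS] by simp
  also have "\<dots> = (x - 1 - ?y) / (x - ?y) - (\<Sum>r\<in>S. ?W r / (x - l r) * ((x - 1 - ?y) / (x - ?y)))"
    by (simp only: left_diff_distrib sum_distrib_right mult_1)
  also have "(\<Sum>r\<in>S. ?W r / (x - l r) * ((x - 1 - ?y) / (x - ?y)))
      = (\<Sum>r\<in>S. shift_ratio l (insert a S) r / (x - l r)) - (\<Sum>r\<in>S. ?W r / (?y - l r)) / (x - ?y)"
    unfolding sum_divide_distrib sum_subtractf[symmetric] by (rule sum.cong[OF refl tm])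
  also have "(x - 1 - ?y) / (x - ?y) = 1 - 1 / (x - ?y)" using xy by (simp add: field_simps)
  finally show ?case using insert.hyps xy by (simp add: R diff_divide_distrib)
qed simp

text \<open>Both sides are minus the coefficient of \<open>1 / x\<close> in the expansion of
  \<open>P (x - 1) / P x\<close> at infinity. In the induction, the ratio of a new point
  \<open>a\<close> is the partial fraction expansion at \<open>x = l a\<close>, and its sum cancels
  the corrections to the old ratios.\<close>

lemma sum_shift_ratio:
  assumes "finite S" "inj_on l S"
  shows "(\<Sum>r\<in>S. shift_ratio l S r) = card S"
  using assms
proof (induction S rule: finite_induct)
  case (insert a S)
  let ?W = "shift_ratio l S"
  let ?y = "l a"
  have yS: "?y \<notin> l ` S" and inj: "inj_on l S" using insert.prems insert.hyps by auto
  have R: "shift_ratio l (insert a S) a = 1 - (\<Sum>r\<in>S. ?W r / (?y - l r))"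
    using shift_ratio_insert_new[OF insert.hyps(2)]
      prod_shift_partial_fractions[OF insert.hyps(1) inj yS] by simp
  have "shift_ratio l (insert a S) r = ?W r + ?W r / (?y - l r)" if "r \<in> S" for r
  proof -
    have "l r \<noteq> ?y" using imageI[OF that, of l] yS by auto
    then show ?thesis
      unfolding shift_ratio_insert[OF insert.hyps that]
      by (simp add: shift_factor distrib_left)
  qed
  then show ?case using insert by (simp add: R sum.distrib)
qed simp

text \<open>The next coefficient at infinity, that of \<open>1 / x^2\<close>, by the same induction.
  It drives the recursion for tableau numbers in \<open>nwords_dominant\<close>.\<close>

lemma sum_mult_shift_ratio:
  assumes "finite S" "inj_on l S"
  shows "(\<Sum>r\<in>S. l r * shift_ratio l S r) = sum l S - real (card S) * (real (card S) - 1) / 2"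
  using assms
proof (induction S rule: finite_induct)
  case (insert a S)
  let ?W = "shift_ratio l S"
  let ?y = "l a"
  have yS: "?y \<notin> l ` S" and inj: "inj_on l S" using insert.prems insert.hyps by auto
  have R: "shift_ratio l (insert a S) a = 1 - (\<Sum>r\<in>S. ?W r / (?y - l r))"
    using shift_ratio_insert_new[OF insert.hyps(2)]
      prod_shift_partial_fractions[OF insert.hyps(1) inj yS] by simp
  have tm: "l r * shift_ratio l (insert a S) r = l r * ?W r - ?W r + ?y * (?W r / (?y - l r))"
    if "r \<in> S" for r
  proof -
    have ne: "l r \<noteq> ?y" using imageI[OF that, of l] yS by auto
    then have "?y * (?W r / (?y - l r)) = ?W r + l r * (?W r / (?y - l r))"
      by (simp add: field_simps)
    then show ?thesis
      unfolding shift_ratio_insert[OF insert.hyps that]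
      by (simp add: shift_factor[OF ne] distrib_left)
  qed
  have "(\<Sum>r\<in>S. l r * shift_ratio l (insert a S) r)
      = (\<Sum>r\<in>S. l r * ?W r) - (\<Sum>r\<in>S. ?W r) + ?y * (\<Sum>r\<in>S. ?W r / (?y - l r))"
    unfolding sum_distrib_left sum_subtractf[symmetric] sum.distrib[symmetric]
    by (rule sum.cong[OF refl tm])
  then have "(\<Sum>r\<in>insert a S. l r * shift_ratio l (insert a S) r)
      = (\<Sum>r\<in>S. l r * ?W r) - (\<Sum>r\<in>S. ?W r) + ?y"
    using insert.hyps by (simp add: R right_diff_distrib)
  then show ?case
    using insert.hyps insert.IH[OF inj] sum_shift_ratio[OF insert.hyps(1) inj]
    by (simp add: field_simps)
qed simp

section \<open>Vandermonde products and the count of reduced words\<close>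

definition pairs :: "nat \<Rightarrow> (nat \<times> nat) set" where
  "pairs n = (SIGMA i:{1..n}. {i<..n})"

text \<open>
  With \<open>l i = \<lambda>\<^sub>i + n - i\<close> this is the number of standard Young tableaux of shape \<open>\<lambda>\<close>, divided
  by the factorial of the size of \<open>\<lambda>\<close>.
\<close>

definition frobenius :: "nat \<Rightarrow> (nat \<Rightarrow> nat) \<Rightarrow> real" where
  "frobenius n l = (\<Prod>(i, j)\<in>pairs n. real (l i) - real (l j)) / (\<Prod>i=1..n. fact (l i))"

lemma finite_pairs [simp]: "finite (pairs n)"
  by (simp add: pairs_def)

text \<open>Only pairs containing \<open>r\<close> change, and
  \<open>x \<mapsto> (min x r, max x r)\<close> lists them. If \<open>r\<close> is the second
  component, both differences change sign and the quotient is the same.\<close>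

lemma prod_pairs_decrement:
  fixes l :: "nat \<Rightarrow> real"
  assumes inj: "inj_on l {1..n}" and r: "r \<in> {1..n}"
  defines "l' \<equiv> l(r := l r - 1)"
  shows "(\<Prod>(i, j)\<in>pairs n. l' i - l' j) = (\<Prod>(i, j)\<in>pairs n. l i - l j) * shift_ratio l {1..n} r"
proof -
  let ?g = "\<lambda>x. (l r - 1 - l x) / (l r - l x)"
  let ?q = "\<lambda>(i, j). (l' i - l' j) / (l i - l j)"
  let ?f = "\<lambda>x. (min x r, max x r)"
  have nz: "l i - l j \<noteq> 0" if "(i, j) \<in> pairs n" for i j
    using that inj_on_eq_iff[OF inj, of i j] by (auto simp: pairs_def)
  have "inj_on ?f ({1..n} - {r})"
    by (rule inj_onI) (auto simp: min_def max_def split: if_splits)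
  moreover have "?q (?f x) = ?g x" if x: "x \<in> {1..n} - {r}" for x
  proof (cases "x < r")
    case True
    have "(l x - (l r - 1)) / (l x - l r) = - (l r - 1 - l x) / - (l r - l x)" by simp
    also have "\<dots> = ?g x" by (rule minus_divide_divide)
    finally show ?thesis using True by (simp add: l'_def)
  qed (use x in \<open>auto simp: l'_def\<close>)
  ultimately have "shift_ratio l {1..n} r = prod ?q (?f ` ({1..n} - {r}))"
    unfolding shift_ratio_def by (subst prod.reindex) (auto intro!: prod.cong)
  also have "\<dots> = prod ?q (pairs n)"
  proof (rule prod.mono_neutral_left)
    show "?f ` ({1..n} - {r}) \<subseteq> pairs n"
      using r by (auto simp: pairs_def min_def max_def)
    show "\<forall>x\<in>pairs n - ?f ` ({1..n} - {r}). ?q x = 1"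
    proof
      fix x assume x: "x \<in> pairs n - ?f ` ({1..n} - {r})"
      obtain i j where ij: "x = (i, j)" by (cases x)
      have mem: "1 \<le> i" "i < j" "j \<le> n" using x ij by (auto simp: pairs_def)
      have "i \<noteq> r"
      proof
        assume "i = r"
        then have "x = ?f j" "j \<in> {1..n} - {r}" using mem ij by auto
        then show False using x by blast
      qed
      moreover have "j \<noteq> r"
      proof
        assume "j = r"
        then have "x = ?f i" "i \<in> {1..n} - {r}" using mem ij by auto
        then show False using x by blast
      qed
      ultimately show "?q x = 1" using nz x ij by (simp add: l'_def)
    qed
  qed simp
  finally have "(\<Prod>(i, j)\<in>pairs n. l i - l j) * shift_ratio l {1..n} r
      = (\<Prod>p\<in>pairs n. (case p of (i, j) \<Rightarrow> l i - l j) * ?q p)"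
    by (simp add: prod.distrib)
  also have "\<dots> = (\<Prod>(i, j)\<in>pairs n. l' i - l' j)"
    using nz by (intro prod.cong) auto
  finally show ?thesis ..
qed

text \<open>The Vandermonde numerator acquires the shift ratio, and the factorial of
  \<open>l r\<close> in the denominator loses the factor \<open>l r\<close>.\<close>

lemma frobenius_decrement:
  assumes inj: "inj_on l {1..n}" and r: "r \<in> {1..n}" "0 < l r"
  shows "frobenius n (l(r := l r - 1))
    = frobenius n l * (real (l r) * shift_ratio (\<lambda>i. real (l i)) {1..n} r)"
proof -
  let ?l' = "l(r := l r - 1)"
  have real': "real (?l' i) = ((\<lambda>i. real (l i))(r := real (l r) - 1)) i" for i
    using r(2) by (simp add: of_nat_diff)
  have "inj_on (\<lambda>i. real (l i)) {1..n}"
    by (rule inj_onI) (metis inj inj_onD of_nat_eq_iff)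
  then have num: "(\<Prod>(i, j)\<in>pairs n. real (?l' i) - real (?l' j))
    = (\<Prod>(i, j)\<in>pairs n. real (l i) - real (l j)) * shift_ratio (\<lambda>i. real (l i)) {1..n} r"
    unfolding real' by (rule prod_pairs_decrement[OF _ r(1)])
  have "(\<Prod>i=1..n. fact (l i)) = fact (l r) * (\<Prod>i\<in>{1..n} - {r}. fact (l i) :: real)"
    using r by (simp add: prod.remove)
  also have "(\<Prod>i\<in>{1..n} - {r}. fact (l i) :: real) = (\<Prod>i\<in>{1..n} - {r}. fact (?l' i))"
    by (intro prod.cong) auto
  also have "fact (l r) = real (l r) * fact (?l' r)"
    using r(2) by (simp add: fact_reduce)
  finally have "(\<Prod>i=1..n. fact (l i)) = real (l r) * (\<Prod>i=1..n. fact (?l' i) :: real)"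
    using r by (simp add: prod.remove)
  then show ?thesis using num r(2) by (simp add: frobenius_def)
qed

lemma prod_differences_eq_fact:
  "i \<le> n \<Longrightarrow> (\<Prod>j\<in>{i<..n}. real j - real i) = fact (n - i)"
proof (induction n rule: dec_induct)
  case (step n)
  have "{i<..Suc n} = insert (Suc n) {i<..n}" using step by auto
  then show ?case using step by (simp add: Suc_diff_le of_nat_diff)
qed simp

text \<open>The empty shape, hence the identity permutation: grouped by the first index, the
  Vandermonde product is the product of the factorials in the denominator.\<close>

lemma frobenius_staircase_base: "frobenius n (\<lambda>i. n - i) = 1"
proof -
  have "(\<Prod>(i, j)\<in>pairs n. real (n - i) - real (n - j)) = (\<Prod>i=1..n. \<Prod>j\<in>{i<..n}. real j - real i)"
    unfolding pairs_def by (subst prod.Sigma[symmetric]) (auto intro!: prod.cong simp: of_nat_diff)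
  also have "\<dots> = (\<Prod>i=1..n. fact (n - i))"
    by (intro prod.cong) (auto simp: prod_differences_eq_fact)
  finally show ?thesis by (simp add: frobenius_def)
qed

lemma inversions_eq_0:
  assumes pw: "permutation w" and "inversions w = 0"
  shows "w = id"
proof
  fix i
  have "Inversions w = {}" using assms finite_Inversions[OF pw] by simp
  then have mono: "w i < w j" if "i < j" for i j
    using that permutation_eq_iff[OF pw, of i j] by (force simp: Inversions_def)
  have w: "w (inv w x) = x" for x using permutation_inverse_works(2)[OF pw] by (metis comp_apply id_apply)
  have ge: "x \<le> w x" for x by (rule strict_mono_imp_increasing) (simp add: strict_mono_def mono)
  have "inv w i \<le> i" using ge[of "inv w i"] w by simp
  moreover have "inv w i < i \<Longrightarrow> i < w i" using mono w by metis
  moreover have "i \<le> inv w i"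
  proof (rule strict_mono_imp_increasing)
    show "strict_mono (inv w)"
      unfolding strict_mono_def using mono w by (metis linorder_neqE_nat order_less_asym)
  qed
  ultimately show "w i = id i" using w[of i] by simp
qed

text \<open>Induction over the last letter. At a descent \<open>r\<close>,
  \<open>nwords_dominant_descent\<close> replaces \<open>w \<circ> adj r\<close> by a dominant
  permutation whose code is lowered by one at \<open>r\<close>; \<open>frobenius_decrement\<close>
  evaluates it, and \<open>sum_mult_shift_ratio\<close> adds up the resulting factors.\<close>

theorem nwords_dominant:
  assumes "dominant w" "w permutes {1..n}"
  shows "real (nwords w) = fact (inversions w) * frobenius n (\<lambda>i. code w i + (n - i))"
  using assms
proof (induction "inversions w" arbitrary: w rule: less_induct)
  case less
  have w: "w permutes {1..n}" and dom: "dominant w" using less.prems by auto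
  have pw: "permutation w" using w by (rule permutes_imp_permutation[rotated]) simp
  show ?case
  proof (cases "w = id")
    case True
    then have "code w = (\<lambda>i. 0)" by (auto simp: code_def)
    then show ?thesis using True frobenius_staircase_base by simp
  next
    case False
    define L where "L i = code w i + (n - i)" for i
    let ?R = "\<lambda>r. real (L r) * shift_ratio (\<lambda>i. real (L i)) {1..n} r"
    let ?D = "{r. w (Suc r) < w r}"
    have D: "?D \<subseteq> {1..n}" using descent_bounds[OF w] by fastforce
    have lt: "L k < L i" if "i \<in> {1..n}" "k \<in> {1..n}" "i < k" for i k
      using that dominant_antimono[OF dom, of i k] by (simp add: L_def)
    have inj: "inj_on L {1..n}"
      by (rule inj_onI) (metis lt less_irrefl linorder_neqE_nat)
    \<comment> \<open>Rows from which no box can be removed contribute nothing: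
      \<open>L n = 0\<close> for the last one, and otherwise \<open>L r - 1 = L (Suc r)\<close>
      makes a factor of the shift ratio vanish. So the sum over descents extends to all of
      \<open>{1..n}\<close>.\<close>
    have R0: "?R r = 0" if r: "r \<in> {1..n} - ?D" for r
    proof (cases "r = n")
      case True
      have "{j. n < j \<and> w j < w n} = {}"
        using permutes_not_in[OF w] permutes_in_image[OF w, of n] r True by fastforce
      then have "code w n = 0" by (simp only: code_def card.empty)
      then show ?thesis using True by (simp add: L_def)
    next
      case False
      then have "code w (Suc r) = code w r"
        using r dominant_antimono[OF dom, of r "Suc r"] code_descent_iff[OF pw, of r] by auto
      then have "L r = Suc (L (Suc r))" using r False by (auto simp: L_def)
      moreover have "Suc r \<in> {1..n} - {r}" using r False by auto
      ultimately have "shift_ratio (\<lambda>i. real (L i)) {1..n} r = 0"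
        unfolding shift_ratio_def by (subst prod_zero_iff) auto
      then show ?thesis by simp
    qed
    have step: "real (nwords (w \<circ> adj r)) = fact (inversions w - 1) * (frobenius n L * ?R r)"
      if d: "r \<in> ?D" for r
    proof -
      have d': "w (Suc r) < w r" using d by simp
      obtain j where j: "r < j" "w j < w r" "\<forall>x>r. w x < w r \<longrightarrow> w x \<le> w j"
        using ex_lower_cover[OF pw d'] by blast
      have r: "1 \<le> r" "Suc r \<le> n" using descent_bounds[OF w d'] by auto
      let ?u = "w \<circ> tr r j"
      have pos: "0 < code w r" using code_descent_iff[OF pw, of r] d' by simp
      have u: "?u permutes {1..n}"
        using r lower_position_le[OF w r(1) j(1,2)] j(1)
        by (intro permutes_compose w permutes_swap_id) auto
      have cu: "code ?u i = (if i = r then code w r - 1 else code w i)" for i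
        by (rule code_comp_tr[OF pw j])
      have "inversions w = code w r + sum (code w) ({1..n} - {r})"
        using r by (simp add: inversions_eq_sum_code[OF w] sum.remove)
      moreover have "inversions ?u = code ?u r + sum (code ?u) ({1..n} - {r})"
        using r unfolding inversions_eq_sum_code[OF u] by (subst sum.remove[of _ r]) auto
      moreover have "sum (code ?u) ({1..n} - {r}) = sum (code w) ({1..n} - {r})"
        by (intro sum.cong) (auto simp: cu)
      ultimately have inv_u: "inversions ?u = inversions w - 1" "inversions ?u < inversions w"
        using pos cu[of r] by auto
      have Lu: "(\<lambda>i. code ?u i + (n - i)) = L(r := L r - 1)"
        using pos by (auto simp: fun_eq_iff cu L_def)
      have "real (nwords ?u) = fact (inversions w - 1) * frobenius n (L(r := L r - 1))"
        using less.hyps[OF inv_u(2) dominant_comp_tr[OF dom pw d' j] u] unfolding Lu inv_u(1) .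
      also have "frobenius n (L(r := L r - 1)) = frobenius n L * ?R r"
        using r pos by (intro frobenius_decrement[OF inj]) (auto simp: L_def)
      finally show ?thesis using nwords_dominant_descent[OF dom w d' j] by (simp only:)
    qed
    \<comment> \<open>The numbers \<open>n - i\<close> add up to \<open>n (n - 1) / 2\<close>, which
      cancels the correction in \<open>sum_mult_shift_ratio\<close> and leaves the sum of the
      code.\<close>
    have sumL: "(\<Sum>r=1..n. ?R r) = inversions w"
    proof -
      have "(\<Sum>r=1..n. real (n - r)) = real n * (real n - 1) / 2"
      proof -
        have "(\<Sum>r=1..n. real r) = real n * (real n + 1) / 2"
          by (induction n) (auto simp: field_simps)
        then show ?thesis by (simp add: of_nat_diff sum_subtractf field_simps)
      qed
      then have sumL: "(\<Sum>i=1..n. real (L i)) = (\<Sum>i=1..n. real (code w i)) + real n * (real n - 1) / 2"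
        by (simp only: L_def of_nat_add sum.distrib)
      moreover have "inj_on (\<lambda>i. real (L i)) {1..n}"
    by (rule inj_onI) (metis inj inj_onD of_nat_eq_iff)
      ultimately show ?thesis
        using sum_mult_shift_ratio[of "{1..n}" "\<lambda>i. real (L i)"] sumL
        by (simp add: inversions_eq_sum_code[OF w])
    qed
    have N: "inversions w \<noteq> 0"
      using False inversions_eq_0[OF pw] by blast
    have "real (nwords w) = (\<Sum>r\<in>?D. real (nwords (w \<circ> adj r)))"
      using nwords_right[OF pw False] by simp
    also have "\<dots> = fact (inversions w - 1) * (frobenius n L * (\<Sum>r\<in>?D. ?R r))"
      by (simp add: step sum_distrib_left)
    also have "(\<Sum>r\<in>?D. ?R r) = (\<Sum>r=1..n. ?R r)"
      using D R0 by (intro sum.mono_neutral_left) auto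
    also have "fact (inversions w - 1) * (frobenius n L * (\<Sum>r=1..n. ?R r)) = fact (inversions w) * frobenius n L"
      using N by (simp only: sumL) (simp add: fact_reduce)
    finally show ?thesis unfolding L_def .
  qed
qed

section \<open>The distribution of the last swap\<close>

lemma reverse_perm_permutes: "reverse_perm n permutes {1..n}"
proof (rule bij_imp_permutes)
  show "bij_betw (reverse_perm n) {1..n} {1..n}"
    by (rule bij_betw_byWitness[where f' = "reverse_perm n"]) (auto simp: reverse_perm_def)
qed (auto simp: reverse_perm_def)

lemma permutation_reverse_perm: "permutation (reverse_perm n)"
  using reverse_perm_permutes by (rule permutes_imp_permutation[rotated]) simp

lemma code_reverse_perm: "code (reverse_perm n) i = (if 1 \<le> i then n - i else 0)"
proof -
  have "{j. i < j \<and> reverse_perm n j < reverse_perm n i} = (if 1 \<le> i then {i<..n} else {})"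
    by (auto simp: reverse_perm_def split: if_splits)
  then show ?thesis by (simp add: code_def)
qed

lemma dominant_reverse_perm: "dominant (reverse_perm n)"
  by (auto simp: dominant_def code_reverse_perm)

lemma inversions_reverse_perm: "inversions (reverse_perm n) = n choose 2"
proof -
  have "(\<Sum>i=1..n. n - i) = (\<Sum>i<n. i)"
    by (rule sum.reindex_bij_witness[of _ "\<lambda>i. n - i" "\<lambda>i. n - i"]) auto
  also have "\<dots> = n choose 2"
    by (induction n) (auto simp: choose_two numeral_2_eq_2)
  finally have "(\<Sum>i=1..n. n - i) = n choose 2" .
  moreover have "inversions (reverse_perm n) = (\<Sum>i=1..n. n - i)"
    unfolding inversions_eq_sum_code[OF reverse_perm_permutes]
    by (intro sum.cong) (auto simp: code_reverse_perm)
  ultimately show ?thesis by simp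
qed

text \<open>The coefficient of \<open>x^k\<close> in the power series of \<open>(1 - x)\<close> to
  the power \<open>-3/2\<close>.\<close>

definition half_ratio :: "nat \<Rightarrow> real" where
  "half_ratio k = pochhammer (3/2) k / fact k"

lemma half_ratio_prod: "half_ratio k = (\<Prod>d=1..k. (2 * real d + 1) / (2 * real d))"
proof (induction k)
  case (Suc k)
  have "half_ratio (Suc k) = half_ratio k * ((3 / 2 + real k) / (1 + real k))"
    by (simp add: half_ratio_def pochhammer_Suc)
  also have "(3 / 2 + real k) / (1 + real k) = (2 * real (Suc k) + 1) / (2 * real (Suc k))"
    by (simp add: field_simps)
  finally show ?case using Suc by simp
qed (simp add: half_ratio_def)

lemma half_ratio_prod':
  assumes "m \<ge> 1"
  shows "2 * real m * (\<Prod>d=1..m. (2 * real d - 1) / (2 * real d)) = half_ratio (m - 1)"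
  using assms
proof (induction m rule: dec_induct)
  case (step m)
  have "half_ratio m = half_ratio (m - 1) * ((2 * real m + 1) / (2 * real m))"
    using step by (cases m) (simp_all add: half_ratio_prod)
  moreover have "(\<Prod>d=1..m. (2 * real d - 1) / (2 * real d)) = half_ratio (m - 1) / (2 * real m)"
    using step by (simp add: field_simps)
  moreover have "2 * real (Suc m) * ((2 * real (Suc m) - 1) / (2 * real (Suc m))) = 2 * real m + 1"
    by (simp add: field_simps)
  ultimately show ?case by simp
qed (simp add: half_ratio_def)

text \<open>The factors with \<open>j < r\<close> form \<open>half_ratio (r - 1)\<close>. Those with
  \<open>j > r\<close> have numerators \<open>2 d - 1\<close> instead of \<open>2 d + 1\<close>; the
  leading factor \<open>2 (n - r)\<close> turns them into \<open>half_ratio (n - r - 1)\<close> by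
  \<open>half_ratio_prod'\<close>.\<close>

lemma shift_ratio_staircase:
  assumes "1 \<le> r" "r < n"
  shows "real (2 * (n - r)) * shift_ratio (\<lambda>i. real (2 * (n - i))) {1..n} r
    = half_ratio (r - 1) * half_ratio (n - r - 1)"
proof -
  let ?f = "\<lambda>j. (real (2 * (n - r)) - 1 - real (2 * (n - j))) / (real (2 * (n - r)) - real (2 * (n - j)))"
  have "{1..n} - {r} = {1..<r} \<union> {r<..n}" using assms by auto
  then have "shift_ratio (\<lambda>i. real (2 * (n - i))) {1..n} r = prod ?f ({1..<r} \<union> {r<..n})"
    unfolding shift_ratio_def by (simp only:)
  also have "\<dots> = prod ?f {1..<r} * prod ?f {r<..n}"
    by (rule prod.union_disjoint) auto
  also have "prod ?f {1..<r} = (\<Prod>d=1..r - 1. (2 * real d + 1) / (2 * real d))"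
  proof (rule prod.reindex_bij_witness[of _ "\<lambda>d. r - d" "\<lambda>j. r - j"])
    fix j assume j: "j \<in> {1..<r}"
    have "?f j = - (2 * real (r - j) + 1) / - (2 * real (r - j))"
      using j assms by (simp add: of_nat_diff algebra_simps)
    then show "(2 * real (r - j) + 1) / (2 * real (r - j)) = ?f j"
      by (simp only: minus_divide_divide)
  qed (use assms in auto)
  also have "\<dots> = half_ratio (r - 1)" by (simp only: half_ratio_prod)
  also have "prod ?f {r<..n} = (\<Prod>d=1..n - r. (2 * real d - 1) / (2 * real d))"
    by (rule prod.reindex_bij_witness[of _ "\<lambda>d. r + d" "\<lambda>j. j - r"])
       (use assms in \<open>auto simp: of_nat_diff algebra_simps\<close>)
  finally show ?thesis
    using half_ratio_prod'[of "n - r"] assms by (simp add: algebra_simps)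
qed

text \<open>For the reverse permutation the largest value below the one at \<open>r\<close> stands
  at \<open>Suc r\<close>, so \<open>reverse_perm n \<circ> adj r\<close> is itself dominant. The
  Frobenius formula applies to both permutations, with \<open>L i = 2 (n - i)\<close> for the
  staircase; \<open>n choose 2\<close> is the quotient of the two factorials.\<close>

lemma nwords_reverse_perm_adj:
  assumes r: "1 \<le> r" "r < n"
  shows "real (n choose 2) * real (nwords (reverse_perm n \<circ> adj r))
    = real (nwords (reverse_perm n)) * (half_ratio (r - 1) * half_ratio (n - r - 1))"
proof -
  let ?w = "reverse_perm n"
  let ?u = "?w \<circ> adj r"
  define L where "L i = 2 * (n - i)" for i
  have d: "?w (Suc r) < ?w r" using r by (auto simp: reverse_perm_def)
  have j: "r < Suc r" "?w (Suc r) < ?w r" "\<forall>x>r. ?w x < ?w r \<longrightarrow> ?w x \<le> ?w (Suc r)"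
    using r by (auto simp: reverse_perm_def)
  have u: "?u permutes {1..n}"
    using r by (intro permutes_compose reverse_perm_permutes permutes_swap_id) auto
  have inv: "n choose 2 = Suc (inversions ?u)"
    using inversions_comp_adj_desc[OF permutation_reverse_perm d] by (simp add: inversions_reverse_perm)
  have frob: "frobenius n l = frobenius n l'" if "\<And>i. i \<in> {1..n} \<Longrightarrow> l i = l' i" for l l'
    using that unfolding frobenius_def pairs_def
    by (intro arg_cong2[of _ _ _ _ "(/)"] prod.cong) auto
  have "real (nwords ?u) = fact (inversions ?u) * frobenius n (\<lambda>i. code ?u i + (n - i))"
    by (intro nwords_dominant dominant_comp_tr dominant_reverse_perm permutation_reverse_perm d j u)
  also have "frobenius n (\<lambda>i. code ?u i + (n - i)) = frobenius n (L(r := L r - 1))"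
    using r by (intro frob) (auto simp: code_comp_tr[OF permutation_reverse_perm j] code_reverse_perm L_def)
  also have "\<dots> = frobenius n L * (real (L r) * shift_ratio (\<lambda>i. real (L i)) {1..n} r)"
    using r by (intro frobenius_decrement inj_onI) (auto simp: L_def)
  also have "real (L r) * shift_ratio (\<lambda>i. real (L i)) {1..n} r = half_ratio (r - 1) * half_ratio (n - r - 1)"
    unfolding L_def using shift_ratio_staircase[OF r] .
  finally have u_eq: "real (nwords ?u) = fact (inversions ?u) * (frobenius n L * (half_ratio (r - 1) * half_ratio (n - r - 1)))" .
  have "real (nwords ?w) = fact (n choose 2) * frobenius n (\<lambda>i. code ?w i + (n - i))"
    using nwords_dominant[OF dominant_reverse_perm reverse_perm_permutes] by (simp add: inversions_reverse_perm)
  also have "frobenius n (\<lambda>i. code ?w i + (n - i)) = frobenius n L"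
    by (intro frob) (auto simp: code_reverse_perm L_def)
  finally show ?thesis unfolding u_eq by (simp add: inv)
qed

text \<open>The factor \<open>k\<close> turns \<open>half_ratio k\<close> into \<open>3/2\<close>
  times a coefficient of \<open>(1 - x)\<close> to the power \<open>-5/2\<close>, with index lowered
  by one. The convolution of two such series is that of the power \<open>-5\<close>, whose
  coefficient at \<open>q\<close> is \<open>(q + 4) choose 4\<close>.\<close>

lemma sum_half_ratio:
  "(\<Sum>k\<le>q + 2. real k * real (q + 2 - k) * (half_ratio k * half_ratio (q + 2 - k)))
    = 9 / 4 * real ((q + 4) choose 4)"
proof -
  define b where "b k = pochhammer (5/2 :: real) k / fact k" for k
  have ab: "real (Suc k) * half_ratio (Suc k) = 3 / 2 * b k" for k
    by (simp add: half_ratio_def b_def pochhammer_rec divide_simps)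
  let ?g = "\<lambda>k. real k * real (q + 2 - k) * (half_ratio k * half_ratio (q + 2 - k))"
  have "(\<Sum>k\<le>q + 2. ?g k) = (\<Sum>k\<in>{1..Suc q}. ?g k)"
    by (rule sum.mono_neutral_right) auto
  also have "\<dots> = (\<Sum>i\<le>q. ?g (Suc i))"
    by (rule sum.reindex_bij_witness[of _ Suc "\<lambda>k. k - 1"]) auto
  also have "\<dots> = (\<Sum>i\<le>q. 9 / 4 * (b i * b (q - i)))"
  proof (rule sum.cong[OF refl])
    fix i assume i: "i \<in> {..q}"
    then have "q + 2 - Suc i = Suc (q - i)" by auto
    then have "?g (Suc i) = (real (Suc i) * half_ratio (Suc i)) * (real (Suc (q - i)) * half_ratio (Suc (q - i)))"
      by simp
    also have "\<dots> = 9 / 4 * (b i * b (q - i))" unfolding ab by simp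
    finally show "?g (Suc i) = 9 / 4 * (b i * b (q - i))" .
  qed
  also have "\<dots> = 9 / 4 * ((\<Sum>i\<le>q. real (q choose i) * pochhammer (5/2) i * pochhammer (5/2) (q - i)) / fact q)"
    unfolding sum_distrib_left sum_divide_distrib
    by (rule sum.cong) (auto simp: b_def binomial_fact)
  also have "(\<Sum>i\<le>q. real (q choose i) * pochhammer (5/2) i * pochhammer (5/2) (q - i)) = pochhammer (real 5) q"
    using pochhammer_binomial_sum[of "5/2 :: real" "5/2" q] by simp
  also have "pochhammer (real 5) q = fact (q + 4) / fact 4"
    using pochhammer_product[of 4 "q + 4" "1 :: real"] by (simp flip: pochhammer_fact)
  also have "fact (q + 4) / fact 4 / fact q = real ((q + 4) choose 4)"
    by (simp add: binomial_fact)
  finally show ?thesis .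
qed

text \<open>With \<open>k = r - 1\<close> and \<open>q = n - 4\<close> the weights
  \<open>r - 1\<close> and \<open>n - 1 - r\<close> become \<open>k\<close> and
  \<open>q + 2 - k\<close>.\<close>

lemma sum_last_letter:
  assumes "n \<ge> 4"
  shows "real (n choose 2) * (\<Sum>r=1..n - 1. real ((r - 1) * (n - 1 - r)) * real (nwords (reverse_perm n \<circ> adj r)))
    = 9 / 4 * real (n choose 4) * real (nwords (reverse_perm n))"
proof -
  have "real (n choose 2) * (\<Sum>r=1..n - 1. real ((r - 1) * (n - 1 - r)) * real (nwords (reverse_perm n \<circ> adj r)))
     = real (nwords (reverse_perm n)) *
       (\<Sum>r=1..n - 1. real (r - 1) * real (n - 1 - r) * (half_ratio (r - 1) * half_ratio (n - r - 1)))"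
    unfolding sum_distrib_left
  proof (rule sum.cong[OF refl])
    fix r assume "r \<in> {1..n - 1}"
    then have r: "1 \<le> r" "r < n" using assms by auto
    show "real (n choose 2) * (real ((r - 1) * (n - 1 - r)) * real (nwords (reverse_perm n \<circ> adj r)))
      = real (nwords (reverse_perm n)) * (real (r - 1) * real (n - 1 - r) * (half_ratio (r - 1) * half_ratio (n - r - 1)))"
      using nwords_reverse_perm_adj[OF r] by (simp add: mult.left_commute)
  qed
  also have "(\<Sum>r=1..n - 1. real (r - 1) * real (n - 1 - r) * (half_ratio (r - 1) * half_ratio (n - r - 1)))
     = (\<Sum>k\<le>(n - 4) + 2. real k * real ((n - 4) + 2 - k) * (half_ratio k * half_ratio ((n - 4) + 2 - k)))"
  proof (rule sum.reindex_bij_witness[of _ Suc "\<lambda>r. r - 1"])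
    fix r assume "r \<in> {1..n - 1}"
    then have "n - 4 + 2 - (r - 1) = n - 1 - r" "n - r - 1 = n - 1 - r" using assms by auto
    then show "real (r - 1) * real (n - 4 + 2 - (r - 1)) * (half_ratio (r - 1) * half_ratio (n - 4 + 2 - (r - 1)))
       = real (r - 1) * real (n - 1 - r) * (half_ratio (r - 1) * half_ratio (n - r - 1))" by simp
  qed (use assms in auto)
  also have "\<dots> = 9 / 4 * real (n choose 4)"
    using sum_half_ratio[of "n - 4"] assms by simp
  finally show ?thesis by (simp only: mult_ac)
qed

section \<open>Sorting networks as reduced words, and their rotation\<close>

lemma reduced_words_letters:
  assumes "\<omega> \<in> reduced_words w" "w permutes {1..n}"
  shows "set \<omega> \<subseteq> {1..n - 1}"
  using assms
proof (induction \<omega> arbitrary: w rule: rev_induct)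
  case (snoc r \<omega>)
  have d: "w (Suc r) < w r" and \<omega>: "\<omega> \<in> reduced_words (w \<circ> adj r)"
    using snoc.prems(1) by (auto simp: snoc_reduced_words_iff)
  have r: "1 \<le> r" "Suc r \<le> n" using descent_bounds[OF snoc.prems(2) d] by auto
  then have "w \<circ> adj r permutes {1..n}"
    by (intro permutes_compose snoc.prems permutes_swap_id) auto
  from snoc.IH[OF \<omega> this] r show ?case by auto
qed simp

text \<open>The prescribed length is the inversion number of the reverse permutation, and reduced
  words of a permutation of \<open>{1..n}\<close> have letters in \<open>{1..n - 1}\<close>.\<close>

lemma networks_eq_reduced_words: "{\<omega>. sorting_network n \<omega>} = reduced_words (reverse_perm n)"
  using reduced_words_letters[OF _ reverse_perm_permutes]
  by (auto simp: sorting_network_def reduced_words_def inversions_reverse_perm)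

lemma sorting_network_iff: "sorting_network n \<omega> \<longleftrightarrow> \<omega> \<in> reduced_words (reverse_perm n)"
  using networks_eq_reduced_words by blast

lemma finite_networks: "finite (reduced_words (reverse_perm n))"
  by (rule finite_reduced_words[OF permutation_reverse_perm])

text \<open>The arguments of the Frobenius formula are strictly decreasing here, so every factor is
  positive. This makes the uniform distribution on networks well defined.\<close>

lemma nwords_reverse_perm_pos: "0 < nwords (reverse_perm n)"
proof -
  have "0 < frobenius n (\<lambda>i. code (reverse_perm n) i + (n - i))"
    unfolding frobenius_def
    by (intro divide_pos_pos prod_pos) (auto simp: pairs_def code_reverse_perm)
  then have "0 < real (nwords (reverse_perm n))"
    by (simp add: nwords_dominant[OF dominant_reverse_perm reverse_perm_permutes])
  then show ?thesis by simp
qed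

text \<open>Conjugation by the reverse permutation reflects location \<open>r\<close> to
  \<open>n - r\<close>; this is why a rotated network is a network.\<close>

lemma adj_reverse_perm:
  assumes "1 \<le> r" "r < n"
  shows "adj (n - r) \<circ> (reverse_perm n \<circ> adj r) = reverse_perm n"
proof
  fix x
  let ?w = "reverse_perm n"
  have w: "?w r = Suc (n - r)" "?w (Suc r) = n - r" using assms by (auto simp: reverse_perm_def)
  consider "x = r" | "x = Suc r" | "x \<noteq> r" "x \<noteq> Suc r" by blast
  then show "(adj (n - r) \<circ> (?w \<circ> adj r)) x = ?w x"
  proof cases
    case 3
    then have "?w x \<noteq> ?w r" "?w x \<noteq> ?w (Suc r)"
      by (simp_all add: permutation_eq_iff[OF permutation_reverse_perm])
    then show ?thesis using 3 w by simp
  qed (simp_all add: w)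
qed

definition rotate_network :: "nat \<Rightarrow> nat list \<Rightarrow> nat list" where
  "rotate_network n \<omega> = (n - last \<omega>) # butlast \<omega>"

lemma network_snoc:
  assumes "\<omega> \<in> reduced_words (reverse_perm n)" "n \<ge> 2"
  obtains u r where "\<omega> = u @ [r]" "1 \<le> r" "r < n"
proof -
  have "length \<omega> = n choose 2" using assms(1) by (simp add: reduced_words_def inversions_reverse_perm)
  then have "\<omega> \<noteq> []" using assms(2) by auto
  then obtain u r where ur: "\<omega> = u @ [r]" by (metis rev_exhaust)
  have "r \<in> {1..n - 1}" using reduced_words_letters[OF assms(1) reverse_perm_permutes] ur by auto
  then show thesis using assms(2) by (intro that[OF ur]) auto
qed

text \<open>The removed last letter can be recovered from its reflection, so rotation is injective,
  and an injective self-map of a finite set is onto.\<close>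

lemma bij_betw_rotate_network:
  assumes n: "n \<ge> 2"
  shows "bij_betw (rotate_network n) (reduced_words (reverse_perm n)) (reduced_words (reverse_perm n))"
proof -
  let ?R = "reduced_words (reverse_perm n)"
  have "rotate_network n \<omega> \<in> ?R" if R: "\<omega> \<in> ?R" for \<omega>
  proof -
    obtain u r where ur: "\<omega> = u @ [r]" "1 \<le> r" "r < n" using network_snoc[OF R n] by blast
    have "swap_prod u = reverse_perm n \<circ> adj r" "length u + 1 = inversions (reverse_perm n)"
    proof -
      have "u \<in> reduced_words (reverse_perm n \<circ> adj r)"
        using R snoc_reduced_words_iff[of u r] unfolding ur(1) by blast
      then show "swap_prod u = reverse_perm n \<circ> adj r" by (simp add: reduced_words_def)
      show "length u + 1 = inversions (reverse_perm n)" using R by (simp add: ur(1) reduced_words_def)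
    qed
    then show ?thesis
      using adj_reverse_perm[OF ur(2,3)] by (simp add: ur(1) rotate_network_def reduced_words_def)
  qed
  moreover have "inj_on (rotate_network n) ?R"
  proof (rule inj_onI)
    fix \<omega> \<omega>' assume *: "\<omega> \<in> ?R" "\<omega>' \<in> ?R" "rotate_network n \<omega> = rotate_network n \<omega>'"
    obtain u r where ur: "\<omega> = u @ [r]" "1 \<le> r" "r < n" using network_snoc[OF *(1) n] by blast
    obtain u' r' where ur': "\<omega>' = u' @ [r']" "1 \<le> r'" "r' < n" using network_snoc[OF *(2) n] by blast
    show "\<omega> = \<omega>'" using *(3) ur ur' by (auto simp: rotate_network_def)
  qed
  ultimately show ?thesis
    using finite_networks endo_inj_surj[of ?R "rotate_network n"] by (auto simp: bij_betw_def)
qed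

lemma sum_network_last:
  fixes g :: "nat \<Rightarrow> real"
  assumes "n \<ge> 2"
  shows "(\<Sum>\<omega>\<in>reduced_words (reverse_perm n). g (last \<omega>))
    = (\<Sum>r=1..n - 1. g r * real (nwords (reverse_perm n \<circ> adj r)))"
proof -
  let ?w = "reverse_perm n"
  have D: "{r. ?w (Suc r) < ?w r} = {1..n - 1}"
    by (auto simp: reverse_perm_def split: if_splits)
  have "?w \<noteq> id"
  proof
    assume "?w = id"
    then have "?w 1 = 1" by simp
    then show False using assms by (simp add: reverse_perm_def)
  qed
  then have R: "reduced_words ?w = (\<Union>r\<in>{1..n - 1}. (\<lambda>\<omega>. \<omega> @ [r]) ` reduced_words (?w \<circ> adj r))"
    using reduced_words_snoc[of ?w] unfolding D by blast
  have fin: "finite (reduced_words (?w \<circ> adj r))" for r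
    by (intro finite_reduced_words permutation_compose permutation_reverse_perm permutation_swap_id)
  have "(\<Sum>\<omega>\<in>reduced_words ?w. g (last \<omega>))
      = (\<Sum>r=1..n - 1. \<Sum>\<omega>\<in>(\<lambda>\<omega>. \<omega> @ [r]) ` reduced_words (?w \<circ> adj r). g (last \<omega>))"
    unfolding R by (rule sum.UNION_disjoint) (auto simp: fin)
  also have "\<dots> = (\<Sum>r=1..n - 1. g r * real (nwords (?w \<circ> adj r)))"
    by (intro sum.cong refl) (simp add: sum.reindex inj_on_def)
  finally show ?thesis .
qed

text \<open>
  Rotation delays every letter by one step, so all times contribute as much as the last one.
\<close>

lemma sum_network_letters:
  fixes g :: "nat \<Rightarrow> real"
  assumes n: "n \<ge> 2" and g: "\<And>r. 1 \<le> r \<Longrightarrow> r < n \<Longrightarrow> g (n - r) = g r"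
  shows "(\<Sum>\<omega>\<in>reduced_words (reverse_perm n). \<Sum>s\<leftarrow>\<omega>. g s)
    = real (n choose 2) * (\<Sum>r=1..n - 1. g r * real (nwords (reverse_perm n \<circ> adj r)))"
proof -
  let ?R = "reduced_words (reverse_perm n)" and ?N = "n choose 2"
  define S where "S i = (\<Sum>\<omega>\<in>?R. g (\<omega> ! i))" for i
  have len: "length \<omega> = ?N" if "\<omega> \<in> ?R" for \<omega>
    using that by (simp add: reduced_words_def inversions_reverse_perm)
  have rot: "S i = (\<Sum>\<omega>\<in>?R. g (rotate_network n \<omega> ! i))" for i
    unfolding S_def by (rule sum.reindex_bij_betw[OF bij_betw_rotate_network[OF n], symmetric])
  \<comment> \<open>A rotated word begins with the reflection of the last letter, and
    \<open>g\<close> is invariant under reflection.\<close>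
  have S0: "S 0 = (\<Sum>\<omega>\<in>?R. g (last \<omega>))"
    unfolding rot
  proof (rule sum.cong[OF refl])
    fix \<omega> assume "\<omega> \<in> ?R"
    then obtain u r where ur: "\<omega> = u @ [r]" "1 \<le> r" "r < n" using network_snoc n by blast
    then show "g (rotate_network n \<omega> ! 0) = g (last \<omega>)" using g by (simp add: rotate_network_def)
  qed
  have S_Suc: "S (Suc i) = S i" if "Suc i < ?N" for i
  proof -
    have "S (Suc i) = (\<Sum>\<omega>\<in>?R. g (rotate_network n \<omega> ! Suc i))" by (rule rot)
    also have "\<dots> = S i"
      unfolding S_def
      by (rule sum.cong) (use that len in \<open>auto simp: rotate_network_def nth_butlast\<close>)
    finally show ?thesis .
  qed
  have S_const: "S i = S 0" if "i < ?N" for i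
    using that by (induction i) (auto simp: S_Suc)
  have "(\<Sum>\<omega>\<in>?R. \<Sum>s\<leftarrow>\<omega>. g s) = (\<Sum>\<omega>\<in>?R. \<Sum>i<?N. g (\<omega> ! i))"
    by (intro sum.cong refl) (simp add: sum_list_sum_nth len atLeast0LessThan)
  also have "\<dots> = (\<Sum>i<?N. S i)" unfolding S_def by (rule sum.swap)
  also have "\<dots> = real ?N * S 0" using S_const by simp
  finally show ?thesis unfolding S0 sum_network_last[OF n] .
qed

section \<open>Subnetworks\<close>

text \<open>Locations count from 1 and list indices from 0, so location \<open>s\<close> concerns
  the indices \<open>s - 1\<close> and \<open>s\<close>.\<close>

definition swap_at :: "nat \<Rightarrow> 'a list \<Rightarrow> 'a list" where
  "swap_at s xs = xs[s - 1 := xs ! s, s := xs ! (s - 1)]"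

fun swap_trace :: "'a list \<Rightarrow> nat list \<Rightarrow> 'a list list" where
  "swap_trace xs [] = [xs]"
| "swap_trace xs (s # \<omega>) = xs # swap_trace (swap_at s xs) \<omega>"

text \<open>Every swap exchanges an increasing pair; \<open>inversions_eq_length_iff\<close>
  identifies this with reducedness.\<close>

fun ascending :: "nat list \<Rightarrow> nat list \<Rightarrow> bool" where
  "ascending xs [] \<longleftrightarrow> True"
| "ascending xs (s # \<omega>) \<longleftrightarrow> xs ! (s - 1) < xs ! s \<and> ascending (swap_at s xs) \<omega>"

text \<open>An explicit recursion for the word of the induced subnetwork. A swap survives if both
  particles are in \<open>A\<close>, and its new location is one more than the number of particles
  of \<open>A\<close> to their left.\<close>

fun subword :: "nat set \<Rightarrow> nat list \<Rightarrow> nat list \<Rightarrow> nat list" where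
  "subword A xs [] = []"
| "subword A xs (s # \<omega>) =
     (if xs ! (s - 1) \<in> A \<and> xs ! s \<in> A then [Suc (length (filter (\<lambda>x. x \<in> A) (take (s - 1) xs)))] else [])
     @ subword A (swap_at s xs) \<omega>"

lemma length_swap_at [simp]: "length (swap_at s xs) = length xs"
  by (simp add: swap_at_def)

lemma swap_at_append: "swap_at (Suc (length ys)) (ys @ x # y # zs) = ys @ y # x # zs"
  by (simp add: swap_at_def nth_append list_update_append)

lemma split_at_adjacent:
  assumes "1 \<le> s" "s < length xs"
  obtains ys x y zs where "xs = ys @ x # y # zs" "s = Suc (length ys)"
proof -
  have "xs = take (s - 1) xs @ xs ! (s - 1) # drop s xs"
    using id_take_nth_drop[of "s - 1" xs] assms by simp
  also have "drop s xs = xs ! s # drop (Suc s) xs" using assms by (simp add: Cons_nth_drop_Suc)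
  finally show thesis using assms by (intro that[of "take (s - 1) xs"]) auto
qed

lemma map_comp_adj:
  assumes "1 \<le> s" "s < n"
  shows "map (\<sigma> \<circ> adj s) [1..<n + 1] = swap_at s (map \<sigma> [1..<n + 1])"
  by (rule nth_equalityI)
     (use assms in \<open>auto simp: swap_at_def nth_list_update Transposition.transpose_def nth_append
        simp del: upt_Suc split: if_splits\<close>)

lemma swap_trace_map:
  assumes "set \<omega> \<subseteq> {1..n - 1}"
  shows "swap_trace (map \<sigma> [1..<n + 1]) \<omega>
    = map (\<lambda>t. map (\<sigma> \<circ> swap_prod (take t \<omega>)) [1..<n + 1]) [0..<length \<omega> + 1]"
  using assms
proof (induction \<omega> arbitrary: \<sigma>)
  case (Cons s \<omega>)
  have s: "1 \<le> s" "s < n" using Cons.prems by auto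
  have "[0..<length (s # \<omega>) + 1] = 0 # map Suc [0..<length \<omega> + 1]"
    unfolding map_Suc_upt by (subst upt_conv_Cons) (simp_all del: upt_Suc)
  moreover have "swap_trace (swap_at s (map \<sigma> [1..<n + 1])) \<omega>
    = map (\<lambda>t. map (\<sigma> \<circ> swap_prod (take t (s # \<omega>))) [1..<n + 1]) (map Suc [0..<length \<omega> + 1])"
    unfolding map_comp_adj[OF s, symmetric] using Cons.IH[of "\<sigma> \<circ> adj s"] Cons.prems
    by (simp add: comp_def del: upt_Suc)
  ultimately show ?case by (simp del: upt_Suc map_map)
qed simp

lemma configs_eq_swap_trace:
  assumes "set \<omega> \<subseteq> {1..n - 1}"
  shows "configs n \<omega> = swap_trace [1..<n + 1] \<omega>"
  using swap_trace_map[OF assms, of id]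
  by (simp add: configs_def config_def[abs_def] comp_def del: upt_Suc)

text \<open>Each letter changes the inversion number by plus or minus one, so the bound is attained
  exactly when every letter raises it.\<close>

lemma inversions_comp_swap_prod:
  assumes "permutation \<sigma>" "set \<omega> \<subseteq> {1..n - 1}"
  shows "inversions (\<sigma> \<circ> swap_prod \<omega>) \<le> inversions \<sigma> + length \<omega>
    \<and> (inversions (\<sigma> \<circ> swap_prod \<omega>) = inversions \<sigma> + length \<omega> \<longleftrightarrow> ascending (map \<sigma> [1..<n + 1]) \<omega>)"
  using assms
proof (induction \<omega> arbitrary: \<sigma>)
  case (Cons s \<omega>)
  have s: "1 \<le> s" "s < n" using Cons.prems by auto
  have p: "permutation (\<sigma> \<circ> adj s)" using Cons.prems by (simp add: permutation_compose permutation_swap_id)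
  have assoc: "\<sigma> \<circ> swap_prod (s # \<omega>) = \<sigma> \<circ> adj s \<circ> swap_prod \<omega>" by (simp only: swap_prod_Cons comp_assoc)
  have nth: "map \<sigma> [Suc 0..<Suc n] ! (s - Suc 0) = \<sigma> s" "map \<sigma> [Suc 0..<Suc n] ! s = \<sigma> (Suc s)"
    using s by (simp_all del: upt_Suc)
  note IH = Cons.IH[OF p] map_comp_adj[OF s, of \<sigma>]
  show ?case
  proof (cases "\<sigma> s < \<sigma> (Suc s)")
    case True
    then show ?thesis
      using IH Cons.prems inversions_comp_adj[OF Cons.prems(1) True] unfolding assoc
      by (simp add: nth comp_def del: upt_Suc)
  next
    case False
    then have d: "\<sigma> (Suc s) < \<sigma> s"
      using permutation_eq_iff[OF Cons.prems(1), of s "Suc s"] by simp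
    show ?thesis
      using IH Cons.prems inversions_comp_adj_desc[OF Cons.prems(1) d] False unfolding assoc
      by (simp add: nth comp_def del: upt_Suc)
  qed
qed simp

lemma inversions_eq_length_iff:
  assumes "set \<omega> \<subseteq> {1..n - 1}"
  shows "inversions (swap_prod \<omega>) = length \<omega> \<longleftrightarrow> ascending [1..<n + 1] \<omega>"
  using inversions_comp_swap_prod[of id, OF permutation_id assms] by (simp del: upt_Suc)

lemma inversions_take:
  assumes "\<omega> \<in> reduced_words w" "t \<le> length \<omega>"
  shows "inversions (swap_prod (take t \<omega>)) = t"
proof -
  have w: "swap_prod (take t \<omega>) \<circ> swap_prod (drop t \<omega>) = w" "length \<omega> = inversions w"
    using assms(1) by (simp_all add: reduced_words_def flip: swap_prod_append)
  have "inversions w \<le> inversions (swap_prod (take t \<omega>)) + length (drop t \<omega>)"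
    using inversions_comp_swap_prod_le[OF permutation_swap_prod] w(1) by metis
  then show ?thesis
    using w(2) assms(2) inversions_swap_prod_le[of "take t \<omega>"] by simp
qed

lemma swap_trace_not_Nil [simp]: "swap_trace xs \<omega> \<noteq> []"
  by (cases \<omega>) auto

lemma hd_swap_trace [simp]: "hd (swap_trace xs \<omega>) = xs"
  by (cases \<omega>) auto

text \<open>Consecutive configurations determine the letter: of two different locations, the swap at
  the smaller one changes an entry that the other leaves alone. This gives the uniqueness needed for
  the definite description in \<open>subnetwork\<close>.\<close>

lemma swap_trace_inject:
  assumes "distinct xs" "set \<omega> \<subseteq> {1..length xs - 1}" "set \<omega>' \<subseteq> {1..length xs - 1}"
    "swap_trace xs \<omega> = swap_trace xs \<omega>'"
  shows "\<omega> = \<omega>'"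
  using assms
proof (induction \<omega> arbitrary: xs \<omega>')
  case Nil
  then show ?case by (cases \<omega>') (auto simp: swap_trace_not_Nil[symmetric])
next
  case (Cons s \<omega>)
  then obtain s' \<omega>'' where \<omega>': "\<omega>' = s' # \<omega>''" by (cases \<omega>') auto
  have eq: "swap_trace (swap_at s xs) \<omega> = swap_trace (swap_at s' xs) \<omega>''" using Cons.prems \<omega>' by simp
  then have sw: "swap_at s xs = swap_at s' xs" by (metis hd_swap_trace)
  have s: "1 \<le> s" "s < length xs" "1 \<le> s'" "s' < length xs" using Cons.prems \<omega>' by auto
  have "s = s'"
  proof (rule ccontr)
    assume "s \<noteq> s'"
    define a where "a = min s s'"
    have a: "1 \<le> a" "a < length xs" "a < max s s'" using s \<open>s \<noteq> s'\<close> by (auto simp: a_def)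
    have "swap_at a xs ! (a - 1) = xs ! a" "swap_at (max s s') xs ! (a - 1) = xs ! (a - 1)"
      using a by (auto simp: swap_at_def nth_list_update)
    moreover have "swap_at a xs = swap_at (max s s') xs"
      using sw by (auto simp: a_def min_def max_def)
    ultimately have "xs ! a = xs ! (a - 1)" by simp
    then show False using Cons.prems(1) a by (simp add: nth_eq_iff_index_eq)
  qed
  moreover have "distinct (swap_at s xs)"
    using s(1,2)
  proof (rule split_at_adjacent)
    fix ys x y zs assume "xs = ys @ x # y # zs" "s = Suc (length ys)"
    then show ?thesis using Cons.prems(1) by (auto simp: swap_at_append)
  qed
  ultimately have "\<omega> = \<omega>''"
    using Cons.IH[of "swap_at s xs" \<omega>''] Cons.prems eq \<omega>' by simp
  with \<open>s = s'\<close> \<omega>' show ?case by simp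
qed

text \<open>A swap involving at most one particle of \<open>A\<close> leaves the order of the
  particles of \<open>A\<close> unchanged.\<close>

lemma restrict_config_swap_at:
  assumes "1 \<le> s" "s < length xs"
  shows "restrict_config A (swap_at s xs) =
    (if xs ! (s - 1) \<in> A \<and> xs ! s \<in> A
     then swap_at (Suc (length (filter (\<lambda>x. x \<in> A) (take (s - 1) xs)))) (restrict_config A xs)
     else restrict_config A xs)"
  using assms
proof (rule split_at_adjacent)
  fix ys x y zs assume xs: "xs = ys @ x # y # zs" "s = Suc (length ys)"
  let ?f = "\<lambda>ys. map (\<lambda>a. card {b \<in> A. b \<le> a}) (filter (\<lambda>x. x \<in> A) ys)"
  have "swap_at (Suc (length (?f ys))) (?f ys @ u # v # ?f zs) = ?f ys @ v # u # ?f zs" for u v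
    by (rule swap_at_append)
  then show ?thesis
    by (auto simp: xs swap_at_append restrict_config_def nth_append)
qed

text \<open>The equality of sets carries the induction, because \<open>remdups\<close> tests
  membership in the rest of the list. The statement on last entries later identifies the final
  configuration of the subnetwork.\<close>

lemma swap_trace_subword:
  assumes "set \<omega> \<subseteq> {1..length xs - 1}"
  shows "remdups (map (restrict_config A) (swap_trace xs \<omega>)) = remdups (swap_trace (restrict_config A xs) (subword A xs \<omega>))
    \<and> set (map (restrict_config A) (swap_trace xs \<omega>)) = set (swap_trace (restrict_config A xs) (subword A xs \<omega>))
    \<and> restrict_config A (last (swap_trace xs \<omega>)) = last (swap_trace (restrict_config A xs) (subword A xs \<omega>))"
  using assms
proof (induction \<omega> arbitrary: xs)
  case (Cons s \<omega>)
  have s: "1 \<le> s" "s < length xs" using Cons.prems by auto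
  let ?L = "map (restrict_config A) (swap_trace (swap_at s xs) \<omega>)"
  let ?L' = "swap_trace (restrict_config A (swap_at s xs)) (subword A (swap_at s xs) \<omega>)"
  have IH: "remdups ?L = remdups ?L'" "set ?L = set ?L'"
    "restrict_config A (last (swap_trace (swap_at s xs) \<omega>)) = last ?L'"
    using Cons.IH[of "swap_at s xs"] Cons.prems by simp_all
  have in_L: "restrict_config A (swap_at s xs) \<in> set ?L'"
    by (metis hd_swap_trace hd_in_set swap_trace_not_Nil)
  show ?case
  proof (cases "xs ! (s - 1) \<in> A \<and> xs ! s \<in> A")
    case True
    then show ?thesis using IH restrict_config_swap_at[OF s, of A] by simp
  next
    case False
    then have eq: "restrict_config A (swap_at s xs) = restrict_config A xs"
      using restrict_config_swap_at[OF s, of A] by (simp only: if_False)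
    have sub: "subword A xs (s # \<omega>) = subword A (swap_at s xs) \<omega>" using False by simp
    show ?thesis
      unfolding sub eq[symmetric] using IH in_L eq by (auto simp: insert_absorb)
  qed
qed simp

lemma rank_less_iff:
  fixes A :: "nat set"
  assumes "finite A" "a \<in> A" "a' \<in> A"
  shows "card {b \<in> A. b \<le> a} < card {b \<in> A. b \<le> a'} \<longleftrightarrow> a < a'"
proof
  assume "a < a'"
  then have "{b \<in> A. b \<le> a} \<subseteq> {b \<in> A. b \<le> a'}"
    and "a' \<in> {b \<in> A. b \<le> a'}" "a' \<notin> {b \<in> A. b \<le> a}" using assms by auto
  then have "{b \<in> A. b \<le> a} \<subset> {b \<in> A. b \<le> a'}" by blast
  then show "card {b \<in> A. b \<le> a} < card {b \<in> A. b \<le> a'}"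
    using assms(1) by (intro psubset_card_mono) auto
next
  assume less: "card {b \<in> A. b \<le> a} < card {b \<in> A. b \<le> a'}"
  show "a < a'"
  proof (rule ccontr)
    assume "\<not> a < a'"
    then have "{b \<in> A. b \<le> a'} \<subseteq> {b \<in> A. b \<le> a}" by auto
    then have "card {b \<in> A. b \<le> a'} \<le> card {b \<in> A. b \<le> a}"
      using assms(1) by (intro card_mono) auto
    with less show False by simp
  qed
qed

lemma restrict_config_upt:
  assumes "A \<subseteq> {1..n}"
  shows "restrict_config A [1..<n + 1] = [1..<card A + 1]"
proof -
  let ?r = "\<lambda>a. card {b \<in> A. b \<le> a}"
  have fin: "finite A" using assms finite_subset by blast
  have setA: "set (filter (\<lambda>x. x \<in> A) [1..<n + 1]) = A"
    using assms by (auto simp del: upt_Suc)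
  have "?r ` A \<subseteq> {1..card A}"
  proof clarify
    fix a assume "a \<in> A"
    then have "{a} \<subseteq> {b \<in> A. b \<le> a}" by auto
    then have "card {a} \<le> ?r a" using fin by (intro card_mono) auto
    moreover have "?r a \<le> card A" using fin by (intro card_mono) auto
    ultimately show "?r a \<in> {1..card A}" by simp
  qed
  moreover have inj: "inj_on ?r A"
  proof (rule inj_onI)
    fix x y assume "x \<in> A" "y \<in> A" "?r x = ?r y"
    then show "x = y" using rank_less_iff[OF fin, of x y] rank_less_iff[OF fin, of y x] by simp
  qed
  ultimately have img: "?r ` A = {1..card A}"
    by (intro card_subset_eq) (auto simp: card_image)
  have "sorted_wrt (<) (filter (\<lambda>x. x \<in> A) [1..<n + 1])"
    by (intro sorted_wrt_filter sorted_wrt_upt)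
  then have "sorted_wrt (<) (restrict_config A [1..<n + 1])"
    unfolding restrict_config_def sorted_wrt_map
  proof (rule sorted_wrt_mono_rel[rotated])
    fix x y assume "x \<in> set (filter (\<lambda>x. x \<in> A) [1..<n + 1])"
      "y \<in> set (filter (\<lambda>x. x \<in> A) [1..<n + 1])" "x < y"
    then show "?r x < ?r y" unfolding setA using rank_less_iff[OF fin, of x y] by blast
  qed
  moreover have "set (restrict_config A [1..<n + 1]) = {1..card A}"
    unfolding restrict_config_def set_map setA by (rule img)
  ultimately show ?thesis
    by (intro strict_sorted_equal[OF sorted_wrt_upt]) (simp_all add: atLeastLessThanSuc_atLeastAtMost del: upt_Suc)
qed

text \<open>Relabelling by rank preserves order, so each surviving swap still exchanges an
  increasing pair.\<close>

lemma ascending_subword: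
  assumes "finite A" "set \<omega> \<subseteq> {1..length xs - 1}" "ascending xs \<omega>"
  shows "ascending (restrict_config A xs) (subword A xs \<omega>)"
  using assms(2,3)
proof (induction \<omega> arbitrary: xs)
  case (Cons s \<omega>)
  have s: "1 \<le> s" "s < length xs" using Cons.prems by auto
  have IH: "ascending (restrict_config A (swap_at s xs)) (subword A (swap_at s xs) \<omega>)"
    using Cons by auto
  show ?case
  proof (cases "xs ! (s - 1) \<in> A \<and> xs ! s \<in> A")
    case True
    let ?k = "length (filter (\<lambda>x. x \<in> A) (take (s - 1) xs))"
    have "restrict_config A xs ! ?k < restrict_config A xs ! Suc ?k"
      using s
    proof (rule split_at_adjacent)
      fix ys x y zs assume xs: "xs = ys @ x # y # zs" "s = Suc (length ys)"
      then have "x \<in> A" "y \<in> A" "x < y" using True Cons.prems(2) by (auto simp: nth_append)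
      then show ?thesis
        using rank_less_iff[OF assms(1), of x y] by (simp add: xs restrict_config_def nth_append)
    qed
    then show ?thesis using True IH restrict_config_swap_at[OF s, of A] by simp
  next
    case False
    then show ?thesis using IH restrict_config_swap_at[OF s, of A] by (auto split: if_splits)
  qed
qed simp

lemma set_subword:
  assumes "set \<omega> \<subseteq> {1..length xs - 1}"
  shows "set (subword A xs \<omega>) \<subseteq> {1..length (restrict_config A xs) - 1}"
  using assms
proof (induction \<omega> arbitrary: xs)
  case (Cons s \<omega>)
  have s: "1 \<le> s" "s < length xs" using Cons.prems by auto
  have len: "length (restrict_config A (swap_at s xs)) = length (restrict_config A xs)"
    using restrict_config_swap_at[OF s, of A] by simp
  have IH: "set (subword A (swap_at s xs) \<omega>) \<subseteq> {1..length (restrict_config A xs) - 1}"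
    using Cons.IH[of "swap_at s xs"] Cons.prems len by simp
  show ?case
  proof (cases "xs ! (s - 1) \<in> A \<and> xs ! s \<in> A")
    case True
    let ?k = "length (filter (\<lambda>x. x \<in> A) (take (s - 1) xs))"
    have "?k + 2 \<le> length (restrict_config A xs)"
      using s
    proof (rule split_at_adjacent)
      fix ys x y zs assume xs: "xs = ys @ x # y # zs" "s = Suc (length ys)"
      then show ?thesis using True by (auto simp: nth_append restrict_config_def)
    qed
    then show ?thesis using IH True by auto
  qed (use IH in auto)
qed simp

lemma swap_prod_permutes:
  assumes "set \<omega> \<subseteq> {1..n - 1}"
  shows "swap_prod \<omega> permutes {1..n}"
  using assms
proof (induction \<omega>)
  case (Cons s \<omega>)
  then have "adj s \<circ> swap_prod \<omega> permutes {1..n}"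
    by (intro permutes_compose permutes_swap_id) auto
  then show ?case by (simp add: comp_def)
qed (simp add: permutes_id flip: id_def)

lemma last_swap_trace:
  assumes "set \<omega> \<subseteq> {1..n - 1}"
  shows "last (swap_trace [1..<n + 1] \<omega>) = map (swap_prod \<omega>) [1..<n + 1]"
  using swap_trace_map[OF assms, of id] by (simp add: last_map)

lemma map_reverse_perm: "map (reverse_perm n) [1..<n + 1] = rev [1..<n + 1]"
  by (rule nth_equalityI) (auto simp: reverse_perm_def rev_nth simp del: upt_Suc)

text \<open>The configuration at time \<open>t\<close> has exactly \<open>t\<close>
  inversions.\<close>

lemma distinct_configs:
  assumes "sorting_network n \<omega>"
  shows "distinct (configs n \<omega>)"
proof -
  have R: "\<omega> \<in> reduced_words (reverse_perm n)" using assms by (simp add: sorting_network_iff)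
  have sub: "set (take t \<omega>) \<subseteq> {1..n - 1}" for t
    using assms set_take_subset[of t \<omega>] by (auto simp: sorting_network_def)
  have "inj_on (config n \<omega>) (set [0..<length \<omega> + 1])"
  proof (rule inj_onI)
    fix t t' assume t: "t \<in> set [0..<length \<omega> + 1]" "t' \<in> set [0..<length \<omega> + 1]"
      and eq: "config n \<omega> t = config n \<omega> t'"
    have "swap_prod (take t \<omega>) = swap_prod (take t' \<omega>)"
    proof
      fix x
      show "swap_prod (take t \<omega>) x = swap_prod (take t' \<omega>) x"
      proof (cases "x \<in> {1..n}")
        case True
        then have "x \<in> set [1..<n + 1]" by auto
        then show ?thesis using eq unfolding config_def map_eq_conv by blast
      next
        case False
        then show ?thesis using permutes_not_in[OF swap_prod_permutes[OF sub]] by metis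
      qed
    qed
    then show "t = t'" using inversions_take[OF R] t by (metis Suc_eq_plus1 atLeastLessThan_iff less_Suc_eq_le set_upt)
  qed
  then show ?thesis unfolding configs_def distinct_map by simp
qed

text \<open>The subword is ascending, hence reduced, and it ends in the restriction of the reversed
  list, so it is a network. Its configurations are already distinct; thus they equal the list in the
  definition of \<open>subnetwork\<close>, and \<open>swap_trace_inject\<close> gives
  uniqueness.\<close>

lemma subnetwork_eq_subword:
  assumes net: "sorting_network n \<omega>" and A: "A \<subseteq> {1..n}"
  shows "sorting_network (card A) (subword A [1..<n + 1] \<omega>)"
    "subnetwork n A \<omega> = subword A [1..<n + 1] \<omega>"
proof -
  let ?m = "card A" and ?xs = "[1..<n + 1]"
  define \<omega>' where "\<omega>' = subword A ?xs \<omega>"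
  have fin: "finite A" using A finite_subset by blast
  have letters: "set \<omega> \<subseteq> {1..n - 1}" using net by (simp add: sorting_network_def)
  then have lxs: "set \<omega> \<subseteq> {1..length ?xs - 1}" by (simp del: upt_Suc)
  have res: "restrict_config A ?xs = [1..<?m + 1]" by (rule restrict_config_upt[OF A])
  have letters': "set \<omega>' \<subseteq> {1..?m - 1}"
    using set_subword[OF lxs, of A] unfolding res \<omega>'_def by (simp del: upt_Suc)
  have "ascending ?xs \<omega>"
    using net inversions_eq_length_iff[OF letters] by (simp add: sorting_network_def inversions_reverse_perm)
  then have "ascending [1..<?m + 1] \<omega>'"
    using ascending_subword[OF fin lxs] unfolding res \<omega>'_def by blast
  then have len: "inversions (swap_prod \<omega>') = length \<omega>'"
    using inversions_eq_length_iff[OF letters'] by blast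
  note tr = swap_trace_subword[OF lxs, of A, unfolded res, folded \<omega>'_def]
  have "last (swap_trace [1..<?m + 1] \<omega>') = restrict_config A (rev ?xs)"
    using tr last_swap_trace[OF letters] net map_reverse_perm[of n]
    by (simp add: sorting_network_def del: upt_Suc)
  also have "\<dots> = rev [1..<?m + 1]"
    unfolding res[symmetric] by (simp add: restrict_config_def rev_filter rev_map del: upt_Suc)
  finally have "map (swap_prod \<omega>') [1..<?m + 1] = map (reverse_perm ?m) [1..<?m + 1]"
    unfolding last_swap_trace[OF letters'] map_reverse_perm .
  then have on: "swap_prod \<omega>' x = reverse_perm ?m x" if "x \<in> {1..?m}" for x
    using that by (auto simp del: upt_Suc)
  have sp: "swap_prod \<omega>' = reverse_perm ?m"
  proof
    fix x
    show "swap_prod \<omega>' x = reverse_perm ?m x"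
      using on permutes_not_in[OF swap_prod_permutes[OF letters']] permutes_not_in[OF reverse_perm_permutes]
      by (cases "x \<in> {1..?m}") metis+
  qed
  show net': "sorting_network ?m (subword A ?xs \<omega>)"
    using letters' sp len unfolding \<omega>'_def[symmetric]
    by (simp add: sorting_network_def inversions_reverse_perm)
  have conf: "configs ?m \<omega>' = remdups (map (restrict_config A) (configs n \<omega>))"
    using tr distinct_configs[OF net'[folded \<omega>'_def]]
    by (simp only: configs_eq_swap_trace[OF letters] configs_eq_swap_trace[OF letters'] distinct_remdups_id)
  show "subnetwork n A \<omega> = subword A ?xs \<omega>"
    unfolding subnetwork_def \<omega>'_def[symmetric]
  proof (rule the_equality)
    show "sorting_network ?m \<omega>' \<and> configs ?m \<omega>' = remdups (map (restrict_config A) (configs n \<omega>))"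
      using net' conf \<omega>'_def by simp
    fix \<omega>'' assume *: "sorting_network ?m \<omega>'' \<and> configs ?m \<omega>'' = remdups (map (restrict_config A) (configs n \<omega>))"
    have l'': "set \<omega>'' \<subseteq> {1..?m - 1}" using * by (simp add: sorting_network_def)
    have "swap_trace [1..<?m + 1] \<omega>'' = swap_trace [1..<?m + 1] \<omega>'"
      using * conf by (simp only: configs_eq_swap_trace[OF l''] configs_eq_swap_trace[OF letters'])
    then show "\<omega>'' = \<omega>'"
      using l'' letters' by (intro swap_trace_inject[of "[1..<?m + 1]"]) auto
  qed
qed

section \<open>Four-particle networks\<close>

definition ascending_words :: "nat \<Rightarrow> nat list \<Rightarrow> nat list set" where
  "ascending_words k xs = {\<omega>. ascending xs \<omega> \<and> length \<omega> = k \<and> set \<omega> \<subseteq> {1, 2, 3}}"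

lemma ascending_words_0: "ascending_words 0 xs = {[]}"
  by (auto simp: ascending_words_def)

text \<open>Unfolded six times from \<open>[1, 2, 3, 4]\<close>, this equation enumerates the 16
  four-particle networks, so that \<open>count_middle_swaps\<close> can inspect them one by
  one.\<close>

lemma ascending_words_Suc:
  "ascending_words (Suc k) [a, b, c, d] =
     (if a < b then (#) 1 ` ascending_words k [b, a, c, d] else {}) \<union>
     (if b < c then (#) 2 ` ascending_words k [a, c, b, d] else {}) \<union>
     (if c < d then (#) 3 ` ascending_words k [a, b, d, c] else {})"
proof -
  have [simp]: "swap_at (Suc 0) [a, b, c, d] = [b, a, c, d]" "swap_at 2 [a, b, c, d] = [a, c, b, d]"
    "swap_at 3 [a, b, c, d] = [a, b, d, c]"
    by (simp_all add: swap_at_def numeral_2_eq_2 numeral_3_eq_3)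
  show ?thesis
    by (auto simp: ascending_words_def length_Suc_conv)
qed

lemma count_middle_swaps:
  assumes "sorting_network 4 \<omega>"
  shows "count_list \<omega> 2
    = (if \<omega> \<in> {[1,2,3,2,1,2], [3,2,1,2,3,2], [2,1,2,3,2,1], [2,3,2,1,2,3]} then 3 else 2)"
proof -
  have l: "set \<omega> \<subseteq> {1..4 - 1}" and len: "length \<omega> = 6"
    using assms by (auto simp: sorting_network_def choose_two)
  have "ascending [1..<4 + 1] \<omega>"
    using assms inversions_eq_length_iff[OF l] by (simp add: sorting_network_def inversions_reverse_perm)
  moreover have "[1..<4 + 1] = [1, 2, 3, 4 :: nat]" by (simp add: upt_rec)
  moreover have "{1..4 - 1} = {1, 2, 3 :: nat}" by auto
  ultimately have "\<omega> \<in> ascending_words (Suc (Suc (Suc (Suc (Suc (Suc 0)))))) [1, 2, 3, 4]"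
    using l len by (simp add: ascending_words_def)
  then show ?thesis
    by (simp add: ascending_words_Suc ascending_words_0) (elim disjE; simp)
qed

text \<open>These are the sets for which the swap of \<open>x\<close> and \<open>y\<close> becomes
  one at location 2. Such a set consists of \<open>x\<close>, \<open>y\<close>, one particle
  \<open>p\<close> to the left and one particle \<open>q\<close> to the right, chosen
  freely.\<close>

lemma card_sets_one_before_one_after:
  assumes dist: "distinct (ys @ x # y # zs)"
  shows "card {A. A \<subseteq> set (ys @ x # y # zs) \<and> card A = 4 \<and> x \<in> A \<and> y \<in> A
    \<and> length (filter (\<lambda>x. x \<in> A) ys) = 1} = length ys * length zs"
    (is "card ?S = _")
proof -
  let ?f = "\<lambda>(p, q). {x, y, p, q}"
  have ne: "x \<noteq> y" "x \<notin> set ys" "y \<notin> set ys" "x \<notin> set zs" "y \<notin> set zs" "set ys \<inter> set zs = {}"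
    and dy: "distinct ys" and dz: "distinct zs"
    using dist by auto
  have len: "length (filter (\<lambda>x. x \<in> A) ys) = card (A \<inter> set ys)" for A
    using distinct_length_filter[OF dy, of "\<lambda>x. x \<in> A"] by simp
  have inj: "inj_on ?f (set ys \<times> set zs)"
  proof (rule inj_onI, clarify)
    fix p q p' q' assume mem: "p \<in> set ys" "q \<in> set zs" "p' \<in> set ys" "q' \<in> set zs"
      and eq: "{x, y, p, q} = {x, y, p', q'}"
    have "{x, y, p, q} \<inter> set ys = {p}" "{x, y, p', q'} \<inter> set ys = {p'}"
      "{x, y, p, q} \<inter> set zs = {q}" "{x, y, p', q'} \<inter> set zs = {q'}"
      using mem ne by auto
    then show "p = p' \<and> q = q'" unfolding eq by simp
  qed
  have "?f ` (set ys \<times> set zs) = ?S"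
  proof (intro equalityI subsetI)
    fix A assume "A \<in> ?f ` (set ys \<times> set zs)"
    then obtain p q where A: "A = {x, y, p, q}" "p \<in> set ys" "q \<in> set zs" by auto
    then have "p \<noteq> x" "p \<noteq> y" "q \<noteq> x" "q \<noteq> y" "p \<noteq> q" using ne by auto
    then have "card A = 4" using A(1) ne(1) by simp
    moreover have "A \<inter> set ys = {p}" using A ne by auto
    then have "card (A \<inter> set ys) = 1" by simp
    moreover have "A \<subseteq> set (ys @ x # y # zs)" "x \<in> A" "y \<in> A" using A by auto
    ultimately show "A \<in> ?S" unfolding len by blast
  next
    fix A assume "A \<in> ?S"
    then have A: "A \<subseteq> set (ys @ x # y # zs)" "card A = 4" "x \<in> A" "y \<in> A" "card (A \<inter> set ys) = 1"
      by (auto simp: len)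
    have "A = insert x (insert y ((A \<inter> set ys) \<union> (A \<inter> set zs)))" using A by auto
    moreover have "card (insert x (insert y ((A \<inter> set ys) \<union> (A \<inter> set zs)))) = 2 + (card (A \<inter> set ys) + card (A \<inter> set zs))"
      using ne by (subst card_Un_disjoint[symmetric]) auto
    ultimately have "card (A \<inter> set zs) = 1" using A by simp
    then obtain p q where pq: "A \<inter> set ys = {p}" "A \<inter> set zs = {q}"
      using A(5) by (auto simp: card_1_singleton_iff)
    then have "A = ?f (p, q)" "(p, q) \<in> set ys \<times> set zs" using A by auto
    then show "A \<in> ?f ` (set ys \<times> set zs)" by blast
  qed
  then have "card ?S = card (set ys \<times> set zs)" using card_image[OF inj] by simp
  then show ?thesis by (simp add: card_cartesian_product distinct_card dy dz)
qed

text \<open>The number of sets for which a swap moves to location 2 depends only on its location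
  \<open>s\<close>, not on the particles there: \<open>s - 1\<close> particles stand to the left and
  \<open>length xs - 1 - s\<close> to the right.\<close>

lemma sum_count_subword:
  assumes "distinct xs" "set \<omega> \<subseteq> {1..length xs - 1}"
  shows "(\<Sum>A | A \<subseteq> set xs \<and> card A = 4. count_list (subword A xs \<omega>) 2)
    = (\<Sum>s\<leftarrow>\<omega>. (s - 1) * (length xs - 1 - s))"
  using assms
proof (induction \<omega> arbitrary: xs)
  case (Cons s \<omega>)
  have "1 \<le> s" "s < length xs" using Cons.prems by auto
  then show ?case
  proof (rule split_at_adjacent)
    fix ys x y zs assume xs: "xs = ys @ x # y # zs" "s = Suc (length ys)"
    let ?F = "{A. A \<subseteq> set xs \<and> card A = 4}"
    have swap: "swap_at s xs = ys @ y # x # zs" by (simp add: xs swap_at_append)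
    have set': "set (swap_at s xs) = set xs" unfolding swap by (auto simp: xs)
    have dist': "distinct (swap_at s xs)" using Cons.prems(1) unfolding swap by (auto simp: xs)
    have IH: "(\<Sum>A\<in>?F. count_list (subword A (swap_at s xs) \<omega>) 2) = (\<Sum>s\<leftarrow>\<omega>. (s - 1) * (length xs - 1 - s))"
      using Cons.IH[OF dist'] Cons.prems(2) unfolding set' by simp
    have "count_list (subword A xs (s # \<omega>)) 2
       = of_bool (x \<in> A \<and> y \<in> A \<and> length (filter (\<lambda>x. x \<in> A) ys) = 1) + count_list (subword A (swap_at s xs) \<omega>) 2" for A
      by (auto simp: xs nth_append)
    then have "(\<Sum>A\<in>?F. count_list (subword A xs (s # \<omega>)) 2)
       = (\<Sum>A\<in>?F. of_bool (x \<in> A \<and> y \<in> A \<and> length (filter (\<lambda>x. x \<in> A) ys) = 1))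
         + (\<Sum>A\<in>?F. count_list (subword A (swap_at s xs) \<omega>) 2)"
      by (simp add: sum.distrib)
    also have "(\<Sum>A\<in>?F. of_bool (x \<in> A \<and> y \<in> A \<and> length (filter (\<lambda>x. x \<in> A) ys) = 1) :: nat)
       = card {A. A \<subseteq> set xs \<and> card A = 4 \<and> x \<in> A \<and> y \<in> A \<and> length (filter (\<lambda>x. x \<in> A) ys) = 1}"
      by (simp add: Collect_conj_eq[symmetric] conj_assoc)
    also have "\<dots> = length ys * length zs"
      using card_sets_one_before_one_after[of ys x y zs] Cons.prems(1) unfolding xs by blast
    finally show ?thesis unfolding IH by (simp add: xs)
  qed
qed simp

section \<open>The probability as a count of pairs of a network and a set\<close>

lemma card_Int_vimage:
  "finite X \<Longrightarrow> real (card (X \<inter> f -` S)) = (\<Sum>p\<in>X. of_bool (f p \<in> S))"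
  by (simp add: sum_of_bool_eq vimage_def)

lemma pair_pmf_of_set:
  assumes "finite A" "A \<noteq> {}" "finite B" "B \<noteq> {}"
  shows "pair_pmf (pmf_of_set A) (pmf_of_set B) = pmf_of_set (A \<times> B)"
proof (rule pmf_eqI)
  fix p :: "'a \<times> 'b"
  obtain a b where p: "p = (a, b)" by (cases p)
  have "A \<times> B \<noteq> {}" "finite (A \<times> B)" using assms by auto
  then show "pmf (pair_pmf (pmf_of_set A) (pmf_of_set B)) p = pmf (pmf_of_set (A \<times> B)) p"
    using assms by (simp add: p pmf_pair pmf_of_set indicator_def card_cartesian_product)
qed

theorem corollary2:
  fixes n :: nat
  assumes "n \<ge> 4"
  shows "measure_pmf.prob (random_subnetwork 4 n)
           {[1,2,3,2,1,2], [3,2,1,2,3,2], [2,1,2,3,2,1], [2,3,2,1,2,3]} = 1 / 4"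
proof -
  let ?S = "{[1,2,3,2,1,2], [3,2,1,2,3,2], [2,1,2,3,2,1], [2,3,2,1,2,3]} :: nat list set"
  let ?R = "reduced_words (reverse_perm n)" and ?F = "{A. A \<subseteq> {1..n} \<and> card A = 4}"
  let ?f = "\<lambda>(\<omega>, A). subnetwork n A \<omega>"
  have finF: "finite ?F" by simp
  have cardF: "card ?F = n choose 4" by (simp add: n_subsets)
  then have neF: "?F \<noteq> {}" using assms by (metis card.empty binomial_eq_0_iff not_less)
  have neR: "?R \<noteq> {}" using nwords_reverse_perm_pos[of n] by auto
  have pos: "0 < real (card ?R) * real (n choose 4)" using nwords_reverse_perm_pos[of n] assms by simp
  \<comment> \<open>The number of swaps at location 2, minus 2, is the indicator of the
    event.\<close>
  have sub: "count_list (subword A [1..<n + 1] \<omega>) 2 = 2 + of_bool (subnetwork n A \<omega> \<in> ?S)"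
    if "\<omega> \<in> ?R" "A \<in> ?F" for \<omega> A
  proof -
    have net: "sorting_network n \<omega>" and A: "A \<subseteq> {1..n}" "card A = 4"
      using that by (auto simp: sorting_network_iff)
    have eq: "subnetwork n A \<omega> = subword A [1..<n + 1] \<omega>"
      by (rule subnetwork_eq_subword[OF net A(1)])
    have "sorting_network 4 (subword A [1..<n + 1] \<omega>)"
      using subnetwork_eq_subword(1)[OF net A(1)] A(2) by simp
    define u where "u = subword A [1..<n + 1] \<omega>"
    from count_middle_swaps[OF \<open>sorting_network 4 _\<close>]
    show "count_list (subword A [1..<n + 1] \<omega>) 2 = 2 + of_bool (subnetwork n A \<omega> \<in> ?S)"
      unfolding eq u_def[symmetric] by simp
  qed
  \<comment> \<open>The weight is symmetric under reflection of locations, as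
    \<open>sum_network_letters\<close> requires.\<close>
  have g: "real ((n - r - 1) * (n - 1 - (n - r))) = real ((r - 1) * (n - 1 - r))" if "1 \<le> r" "r < n" for r
  proof -
    have "n - 1 - (n - r) = r - 1" "n - r - 1 = n - 1 - r" using that by auto
    then show ?thesis by (simp only: mult.commute)
  qed
  have sum_F: "(\<Sum>A\<in>?F. count_list (subword A [1..<n + 1] \<omega>) 2) = (\<Sum>s\<leftarrow>\<omega>. (s - 1) * (n - 1 - s))"
    if "\<omega> \<in> ?R" for \<omega>
  proof -
    have "set \<omega> \<subseteq> {1..n - 1}" using reduced_words_letters[OF that reverse_perm_permutes] .
    moreover have "{1..<Suc n} = {1..n}" by auto
    ultimately show ?thesis using sum_count_subword[of "[1..<n + 1]" \<omega>] by (simp del: upt_Suc)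
  qed
  \<comment> \<open>The swaps at location 2 over all pairs of a network and a set are counted twice:
    per pair as 2 plus the indicator, and per letter of the network by its weight.\<close>
  have "2 * (real (card ?R) * real (n choose 4)) + (\<Sum>\<omega>\<in>?R. \<Sum>A\<in>?F. of_bool (subnetwork n A \<omega> \<in> ?S))
      = (\<Sum>\<omega>\<in>?R. \<Sum>A\<in>?F. 2 + of_bool (subnetwork n A \<omega> \<in> ?S))"
    by (simp only: sum.distrib sum_constant cardF)
  also have "\<dots> = (\<Sum>\<omega>\<in>?R. \<Sum>A\<in>?F. real (count_list (subword A [1..<n + 1] \<omega>) 2))"
    by (intro sum.cong refl) (simp only: sub, simp)
  also have "\<dots> = (\<Sum>\<omega>\<in>?R. \<Sum>s\<leftarrow>\<omega>. real ((s - 1) * (n - 1 - s)))"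
  proof (rule sum.cong[OF refl])
    fix \<omega> assume \<omega>: "\<omega> \<in> ?R"
    have "(\<Sum>A\<in>?F. real (count_list (subword A [1..<n + 1] \<omega>) 2)) = real (\<Sum>s\<leftarrow>\<omega>. (s - 1) * (n - 1 - s))"
      unfolding sum_F[OF \<omega>, symmetric] by simp
    also have "\<dots> = (\<Sum>s\<leftarrow>\<omega>. real ((s - 1) * (n - 1 - s)))" by (induction \<omega>) auto
    finally show "(\<Sum>A\<in>?F. real (count_list (subword A [1..<n + 1] \<omega>) 2)) = (\<Sum>s\<leftarrow>\<omega>. real ((s - 1) * (n - 1 - s)))" .
  qed
  also have "\<dots> = real (n choose 2) * (\<Sum>r=1..n - 1. real ((r - 1) * (n - 1 - r)) * real (nwords (reverse_perm n \<circ> adj r)))"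
    using assms by (intro sum_network_letters g) auto
  also have "\<dots> = 9 / 4 * (real (card ?R) * real (n choose 4))"
    using sum_last_letter[OF assms] by (simp only: mult_ac)
  \<comment> \<open>The mean number of swaps at location 2 is \<open>9/4\<close>, which exceeds 2 by
    the probability sought.\<close>
  finally have count: "(\<Sum>\<omega>\<in>?R. \<Sum>A\<in>?F. of_bool (subnetwork n A \<omega> \<in> ?S)) = (1 / 4) * (real (card ?R) * real (n choose 4))"
    by simp
  have pair: "pair_pmf (pmf_of_set ?R) (pmf_of_set ?F) = pmf_of_set (?R \<times> ?F)"
    using finite_networks[of n] neR finF neF by (rule pair_pmf_of_set)
  have "measure_pmf.prob (random_subnetwork 4 n) ?S
      = measure_pmf.prob (pmf_of_set (?R \<times> ?F)) (?f -` ?S)"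
    unfolding random_subnetwork_def uniform_network_def networks_eq_reduced_words pair
    by (simp only: measure_map_pmf)
  also have "\<dots> = real (card ((?R \<times> ?F) \<inter> ?f -` ?S)) / real (card (?R \<times> ?F))"
    using finite_networks[of n] finF neR neF by (intro measure_pmf_of_set) auto
  also have "real (card ((?R \<times> ?F) \<inter> ?f -` ?S)) = (\<Sum>p\<in>?R \<times> ?F. of_bool (?f p \<in> ?S))"
    by (rule card_Int_vimage) (use finite_networks[of n] finF in blast)
  also have "\<dots> = (\<Sum>\<omega>\<in>?R. \<Sum>A\<in>?F. of_bool (subnetwork n A \<omega> \<in> ?S))"
    by (simp only: sum.cartesian_product case_prod_unfold)
  also have "\<dots> / real (card (?R \<times> ?F)) = 1 / 4"
    unfolding count card_cartesian_product cardF using pos assms nwords_reverse_perm_pos[of n] by simp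
  finally show ?thesis .
qed

end
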